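(* Let $G$ be a topological group, $(\mathcal L,\eta)$ a host algebra for $G$, $(\mathcal A,G,\alpha)$ a $C^*$-action, and let $(\mathcal C,\eta_{\mathcal A},\eta_{\mathcal L})$ be a crossed product host for $(\alpha,\mathcal L)$. Put $\eta_G:=\tilde\eta_{\mathcal L}\circ\eta: G\to \mathrm U(M(\mathcal C))$. Then for each Hilbert space $\mathcal H$ the map $$\eta_\times^*:\mathrm{Rep}(\mathcal C,\mathcal H)\to \mathrm{Rep}(\alpha,\mathcal H),\qquad \eta_\times^*(\rho):=(\tilde\rho\circ\eta_{\mathcal A},\ \tilde\rho\circ\eta_G)$$ is (well defined and) injective, and its range $\mathrm{Rep}(\alpha,\mathcal H)_{\eta_\times}$ consists of $\mathcal L$-representations of $(\mathcal A,G,\alpha)$. If $\mathcal C$ is a full crossed product host, then moreover $\mathrm{Rep}(\alpha,\mathcal H)_{\eta_\times}=\mathrm{Rep}_{\mathcal L}(\alpha,\mathcal H)$.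
   Context: Conventions. For a $C^*$-algebra $\mathcal B$, $M(\mathcal B)$ denotes its multiplier algebra, with strict topology given by the seminorms $M\mapsto \|MB\|+\|BM\|$, $B\in\mathcal B$. A morphism of $C^*$-algebras $\phi:\mathcal S\to M(\mathcal B)$ is non-degenerate if $\mathrm{span}(\phi(\mathcal S)\mathcal B)$ is dense in $\mathcal B$; it then extends uniquely to a strictly continuous unital homomorphism $\tilde\phi:M(\mathcal S)\to M(\mathcal B)$. $\mathrm{Rep}(\mathcal B,\mathcal H)$ is the set of non-degenerate representations of $\mathcal B$ on the complex Hilbert space $\mathcal H$; each $\pi\in\mathrm{Rep}(\mathcal B,\mathcal H)$ extends uniquely to a representation $\tilde\pi$ of $M(\mathcal B)$ on $\mathcal H$. $\mathrm{Rep}(G,\mathcal H)$ is the set of strong-operator continuous unitary representations of $G$ on $\mathcal H$. Host algebra. A host algebra for a topological group $G$ is a pair $(\mathcal L,\eta)$, with $\mathcal L$ a $C^*$-algebra and $\eta:G\to \mathrm U(M(\mathcal L))$ a group homomorphism, such that (H1) for each non-degenerate representation $\pi$ of $\mathcal L$, $\tilde\pi\circ\eta$ is a continuous unitary representation of $G$; (H2) for each $\mathcal H$ the map $\eta^*:\mathrm{Rep}(\mathcal L,\mathcal H)\to\mathrm{Rep}(G,\mathcal H)$, $\pi\mapsto\tilde\pi\circ\eta$, is injective. Elements of the range of $\eta^*$ are called $\mathcal L$-representations of $G$; for such $U$, $U_{\mathcal L}:=(\eta^* )^{-1}(U)\in\mathrm{Rep}(\mathcal L,\mathcal H)$. Actions.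 A $C^*$-action $(\mathcal A,G,\alpha)$ is a $C^*$-algebra $\mathcal A$, a topological group $G$ and a group homomorphism $\alpha:G\to\mathrm{Aut}(\mathcal A)$ (no continuity assumed). A covariant representation on $\mathcal H$ is a pair $(\pi,U)$ with $\pi\in\mathrm{Rep}(\mathcal A,\mathcal H)$, $U\in\mathrm{Rep}(G,\mathcal H)$ and $U(g)\pi(A)U(g)^*=\pi(\alpha_g(A))$ for all $g\in G$, $A\in\mathcal A$; the set of these is $\mathrm{Rep}(\alpha,\mathcal H)$. $(\pi,U)$ is an $\mathcal L$-representation if $U$ is; the set of these is $\mathrm{Rep}_{\mathcal L}(\alpha,\mathcal H)$. Crossed product host. A triple $(\mathcal C,\eta_{\mathcal A},\eta_{\mathcal L})$, with $\mathcal C$ a $C^*$-algebra, is a crossed product host for $(\alpha,\mathcal L)$ if: (CP1) $\eta_{\mathcal A}:\mathcal A\to M(\mathcal C)$ and $\eta_{\mathcal L}:\mathcal L\to M(\mathcal C)$ are morphisms of $C^*$-algebras; (CP2) $\eta_{\mathcal L}$ is non-degenerate; (CP3) $\tilde\eta_{\mathcal L}(\eta(g))\eta_{\mathcal A}(A)\tilde\eta_{\mathcal L}(\eta(g))^*=\eta_{\mathcal A}(\alpha_g(A))$ for all $A\in\mathcal A$, $g\in G$; (CP4) $\eta_{\mathcal A}(\mathcal A)\eta_{\mathcal L}(\mathcal L)\subseteq\mathcal C$ and $\mathcal C$ is generated as a $C^*$-algebra by this set. It is full if in addition (CP5): for every $(\pi,U)\in\mathrm{Rep}_{\mathcal L}(\alpha,\mathcal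 H)$ (any $\mathcal H$) there is a unique representation $\rho:\mathcal C\to B(\mathcal H)$ with $\rho(\eta_{\mathcal A}(A)\eta_{\mathcal L}(L))=\pi(A)U_{\mathcal L}(L)$ for all $A\in\mathcal A$, $L\in\mathcal L$. *)

theory Defs
  imports "HOL-Analysis.Analysis"
begin

section \<open>Complex normed spaces, Hilbert spaces, C*-algebras\<close>

class scaleC =
  fixes scaleC :: "complex \<Rightarrow> 'a \<Rightarrow> 'a"  (infixr "*\<^sub>C" 75)

class complex_vector = real_vector + scaleC +
  assumes scaleC_add_right: "c *\<^sub>C (x + y) = c *\<^sub>C x + c *\<^sub>C y"
    and scaleC_add_left: "(c + d) *\<^sub>C x = c *\<^sub>C x + d *\<^sub>C x"
    and scaleC_scaleC: "c *\<^sub>C d *\<^sub>C x = (c * d) *\<^sub>C x"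
    and scaleC_one: "1 *\<^sub>C x = x"
    and scaleR_scaleC: "r *\<^sub>R x = complex_of_real r *\<^sub>C x"

class complex_normed_vector = complex_vector + real_normed_vector +
  assumes norm_scaleC: "norm (c *\<^sub>C x) = cmod c * norm x"

text \<open>The inner product is conjugate-linear in the first argument.\<close>

class complex_hilbert = complex_normed_vector + banach +
  fixes cinner :: "'a \<Rightarrow> 'a \<Rightarrow> complex"
  assumes cinner_commute: "cinner x y = cnj (cinner y x)"
    and cinner_add_right: "cinner x (y + z) = cinner x y + cinner x z"
    and cinner_scaleC_right: "cinner x (c *\<^sub>C y) = c * cinner x y"
    and cinner_self: "cinner x x = complex_of_real ((norm x)\<^sup>2)"

text \<open>C*-algebras, not necessarily unital.\<close>

class cstar_algebra = complex_normed_vector + real_normed_algebra + banach +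
  fixes adj :: "'a \<Rightarrow> 'a"
  assumes mult_scaleC_left: "(c *\<^sub>C x) * y = c *\<^sub>C (x * y)"
    and mult_scaleC_right: "x * (c *\<^sub>C y) = c *\<^sub>C (x * y)"
    and adj_adj: "adj (adj x) = x"
    and adj_add: "adj (x + y) = adj x + adj y"
    and adj_scaleC: "adj (c *\<^sub>C x) = cnj c *\<^sub>C adj x"
    and adj_mult: "adj (x * y) = adj y * adj x"
    and cstar_identity: "norm (adj x * x) = (norm x)\<^sup>2"

definition csubspace :: "'a::complex_vector set \<Rightarrow> bool" where
  "csubspace S \<longleftrightarrow> 0 \<in> S \<and> (\<forall>x\<in>S. \<forall>y\<in>S. x + y \<in> S) \<and> (\<forall>c. \<forall>x\<in>S. c *\<^sub>C x \<in> S)"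

definition cstar_subalgebra :: "'a::cstar_algebra set \<Rightarrow> bool" where
  "cstar_subalgebra S \<longleftrightarrow> closed S \<and> csubspace S \<and>
     (\<forall>x\<in>S. \<forall>y\<in>S. x * y \<in> S) \<and> (\<forall>x\<in>S. adj x \<in> S)"

definition star_hom :: "('a::cstar_algebra \<Rightarrow> 'b::cstar_algebra) \<Rightarrow> bool" where
  "star_hom f \<longleftrightarrow> (\<forall>x y. f (x + y) = f x + f y) \<and> (\<forall>c x. f (c *\<^sub>C x) = c *\<^sub>C f x) \<and>
     (\<forall>x y. f (x * y) = f x * f y) \<and> (\<forall>x. f (adj x) = adj (f x))"


section \<open>The multiplier algebra\<close>

lemma adj_scaleR: "adj (r *\<^sub>R x :: 'a::cstar_algebra) = r *\<^sub>R adj x"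
  by (simp add: scaleR_scaleC adj_scaleC)

lemma norm_adj: "norm (adj x :: 'a::cstar_algebra) = norm x"
proof -
  have le: "norm y \<le> norm (adj y)" for y :: 'a
  proof (cases "y = 0")
    case False
    have "norm y * norm y \<le> norm (adj y) * norm y"
      using cstar_identity[of y] norm_mult_ineq[of "adj y" y] by (simp add: power2_eq_square)
    then show ?thesis using False by simp
  qed simp
  show ?thesis using le[of x] le[of "adj x"] by (simp add: adj_adj)
qed

lemma norm_cstar_right: "norm (x * adj x :: 'a::cstar_algebra) = (norm x)\<^sup>2"
  using cstar_identity[of "adj x"] by (simp add: adj_adj norm_adj)

lemma bounded_linear_adj: "bounded_linear (adj :: 'a::cstar_algebra \<Rightarrow> 'a)"
  by (rule bounded_linear_intro[where K = 1]) (simp_all add: adj_add adj_scaleR norm_adj)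

lemma cstar_left_cancel:
  assumes "\<And>z. z * x = z * (y::'a::cstar_algebra)" shows "x = y"
  using cstar_identity[of "x - y"] assms[of "adj (x - y)"] by (simp add: right_diff_distrib)

lemma cstar_right_cancel:
  assumes "\<And>z. x * z = (y::'a::cstar_algebra) * z" shows "x = y"
  using norm_cstar_right[of "x - y"] assms[of "adj (x - y)"] by (simp add: left_diff_distrib)

lemma bounded_linear_scaleC: "bounded_linear (\<lambda>x::'a::complex_normed_vector. c *\<^sub>C x)"
proof (rule bounded_linear_intro[where K = "cmod c"])
  show "c *\<^sub>C r *\<^sub>R x = r *\<^sub>R c *\<^sub>C x" for r and x :: 'a
    by (simp add: scaleR_scaleC scaleC_scaleC mult.commute)
qed (simp_all add: scaleC_add_right norm_scaleC)

lemmas scaleC_zero_right = linear_0[OF bounded_linear.linear[OF bounded_linear_scaleC]]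
  and scaleC_minus_right = linear_neg[OF bounded_linear.linear[OF bounded_linear_scaleC]]
  and scaleC_diff_right = linear_diff[OF bounded_linear.linear[OF bounded_linear_scaleC]]
  and bounded_linear_scaleC_blinfun =
    bounded_linear_compose[OF bounded_linear_scaleC bounded_linear_blinfun_apply[OF bounded_linear_ident]]
  and bounded_linear_adj_blinfun =
    bounded_linear_compose[OF bounded_linear_adj
      bounded_linear_blinfun_apply[OF bounded_linear_adj]]

text \<open>Elements of the multiplier algebra are double centralizers \<open>(l, r)\<close>: \<open>l x\<close> is \<open>M x\<close> and
  \<open>r x\<close> is \<open>x M\<close>.\<close>

typedef (overloaded) 'a multiplier =
  "{(l :: 'a::cstar_algebra \<Rightarrow>\<^sub>L 'a, r :: 'a \<Rightarrow>\<^sub>L 'a).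
      (\<forall>c x. l (c *\<^sub>C x) = c *\<^sub>C l x) \<and> (\<forall>c x. r (c *\<^sub>C x) = c *\<^sub>C r x) \<and>
      (\<forall>x y. x * l y = r x * y)}"
  by (rule exI[of _ "(0, 0)"]) (simp add: scaleC_zero_right)

setup_lifting type_definition_multiplier

lifting_forget blinfun.lifting

lift_definition lmul :: "'a::cstar_algebra multiplier \<Rightarrow> 'a \<Rightarrow>\<^sub>L 'a" is fst .

lift_definition rmul :: "'a::cstar_algebra multiplier \<Rightarrow> 'a \<Rightarrow>\<^sub>L 'a" is snd .

lemma lmul_scaleC: "lmul M (c *\<^sub>C x) = c *\<^sub>C lmul M x"
  by transfer auto

lemma rmul_scaleC: "rmul M (c *\<^sub>C x) = c *\<^sub>C rmul M x"
  by transfer auto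

lemma mult_lmul: "x * lmul M y = rmul M x * y"
  by transfer auto

lemma lmul_mult: "lmul M (x * y) = lmul M x * y"
  by (rule cstar_left_cancel) (simp add: mult_lmul flip: mult.assoc)

lemma rmul_mult: "rmul M (x * y) = x * rmul M y"
proof -
  have "rmul M (x * y) * z = x * rmul M y * z" for z
    by (simp add: mult.assoc flip: mult_lmul)
  then show ?thesis by (rule cstar_right_cancel)
qed

lemma multiplier_eqI:
  assumes "\<And>x. lmul M x = lmul N x" shows "M = N"
proof -
  have "rmul M x = rmul N x" for x
    by (rule cstar_right_cancel) (simp add: assms flip: mult_lmul)
  with assms have "lmul M = lmul N" "rmul M = rmul N"
    by (auto intro: blinfun_eqI)
  then show ?thesis by transfer auto
qed

text \<open>Both components of a double centralizer have the same norm.\<close>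

lemma norm_lmul_rmul: "norm (lmul M) = norm (rmul M)"
proof (rule antisym)
  have "norm (lmul M x) \<le> norm (rmul M) * norm x" for x
  proof (cases "lmul M x = 0")
    case False
    have "(norm (lmul M x))\<^sup>2 = norm (rmul M (adj (lmul M x)) * x)"
      by (simp add: mult_lmul flip: cstar_identity)
    also have "\<dots> \<le> norm (rmul M) * norm (adj (lmul M x)) * norm x"
      by (rule order_trans[OF norm_mult_ineq]) (intro mult_right_mono norm_blinfun norm_ge_zero)
    finally show ?thesis using False by (simp add: norm_adj power2_eq_square mult_ac)
  qed simp
  then show "norm (lmul M) \<le> norm (rmul M)" by (intro norm_blinfun_bound) auto
next
  have "norm (rmul M x) \<le> norm (lmul M) * norm x" for x
  proof (cases "rmul M x = 0")
    case False
    have "(norm (rmul M x))\<^sup>2 = norm (x * lmul M (adj (rmul M x)))"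
      by (simp add: mult_lmul flip: norm_cstar_right)
    also have "\<dots> \<le> norm x * (norm (lmul M) * norm (adj (rmul M x)))"
      by (rule order_trans[OF norm_mult_ineq]) (intro mult_left_mono norm_blinfun norm_ge_zero)
    finally show ?thesis using False by (simp add: norm_adj power2_eq_square mult_ac)
  qed simp
  then show "norm (rmul M) \<le> norm (lmul M)" by (intro norm_blinfun_bound) auto
qed

instantiation multiplier :: (cstar_algebra) "{complex_normed_vector, real_normed_algebra}"
begin

lift_definition zero_multiplier :: "'a multiplier" is "(0, 0)"
  by (simp add: scaleC_zero_right)

lift_definition plus_multiplier :: "'a multiplier \<Rightarrow> 'a multiplier \<Rightarrow> 'a multiplier"
  is "\<lambda>(l, r) (l', r'). (l + l', r + r')"
  by (auto simp: blinfun.add_left scaleC_add_right distrib_left distrib_right)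

lift_definition minus_multiplier :: "'a multiplier \<Rightarrow> 'a multiplier \<Rightarrow> 'a multiplier"
  is "\<lambda>(l, r) (l', r'). (l - l', r - r')"
  by (auto simp: blinfun.diff_left scaleC_diff_right right_diff_distrib left_diff_distrib)

lift_definition uminus_multiplier :: "'a multiplier \<Rightarrow> 'a multiplier"
  is "\<lambda>(l, r). (- l, - r)"
  by (auto simp: blinfun.minus_left scaleC_minus_right)

lift_definition scaleC_multiplier :: "complex \<Rightarrow> 'a multiplier \<Rightarrow> 'a multiplier"
  is "\<lambda>c (l :: 'a \<Rightarrow>\<^sub>L 'a, r :: 'a \<Rightarrow>\<^sub>L 'a). (Blinfun (\<lambda>x. c *\<^sub>C l x), Blinfun (\<lambda>x. c *\<^sub>C r x))"
  by (auto simp: bounded_linear_Blinfun_apply bounded_linear_scaleC_blinfun scaleC_scaleC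
      mult_scaleC_left mult_scaleC_right mult.commute)

definition scaleR_multiplier :: "real \<Rightarrow> 'a multiplier \<Rightarrow> 'a multiplier"
  where "scaleR_multiplier r M = complex_of_real r *\<^sub>C M"

lift_definition times_multiplier :: "'a multiplier \<Rightarrow> 'a multiplier \<Rightarrow> 'a multiplier"
  is "\<lambda>(l, r) (l', r'). (l o\<^sub>L l', r' o\<^sub>L r)"
  by auto

definition norm_multiplier :: "'a multiplier \<Rightarrow> real"
  where "norm_multiplier M = norm (lmul M)"

definition sgn_multiplier :: "'a multiplier \<Rightarrow> 'a multiplier"
  where "sgn_multiplier M = inverse (norm M) *\<^sub>R M"

definition dist_multiplier :: "'a multiplier \<Rightarrow> 'a multiplier \<Rightarrow> real"
  where "dist_multiplier M N = norm (M - N)"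

definition uniformity_multiplier :: "('a multiplier \<times> 'a multiplier) filter"
  where "uniformity_multiplier = (INF e\<in>{0<..}. principal {(M, N). dist M N < e})"

definition open_multiplier :: "'a multiplier set \<Rightarrow> bool"
  where "open_multiplier U \<longleftrightarrow> (\<forall>M\<in>U. eventually (\<lambda>(M', N). M' = M \<longrightarrow> N \<in> U) uniformity)"

lemma lmul_simps:
  fixes M N :: "'a multiplier"
  shows "lmul (M + N) = lmul M + lmul N" "lmul (M - N) = lmul M - lmul N" "lmul (- M) = - lmul M"
    "lmul 0 = (0 :: 'a \<Rightarrow>\<^sub>L 'a)" "lmul (M * N) = lmul M o\<^sub>L lmul N"
    "lmul (c *\<^sub>C M) x = c *\<^sub>C lmul M x"
    "lmul (r *\<^sub>R M) = r *\<^sub>R lmul M"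
proof -
  show *: "lmul (c *\<^sub>C M) x = c *\<^sub>C lmul M x" for c M and x :: 'a
    by transfer (auto simp: bounded_linear_Blinfun_apply bounded_linear_scaleC_blinfun)
  show "lmul (r *\<^sub>R M) = r *\<^sub>R lmul M"
    by (rule blinfun_eqI)
      (simp add: scaleR_multiplier_def * blinfun.scaleR_left flip: scaleR_scaleC)
qed (transfer, auto)+

lemma rmul_simps:
  fixes M N :: "'a multiplier"
  shows "rmul (M + N) = rmul M + rmul N" "rmul (M - N) = rmul M - rmul N" "rmul (- M) = - rmul M"
    "rmul 0 = (0 :: 'a \<Rightarrow>\<^sub>L 'a)" "rmul (M * N) = rmul N o\<^sub>L rmul M"
    "rmul (c *\<^sub>C M) x = c *\<^sub>C rmul M x"
    "rmul (r *\<^sub>R M) = r *\<^sub>R rmul M"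
proof -
  show *: "rmul (c *\<^sub>C M) x = c *\<^sub>C rmul M x" for c M and x :: 'a
    by transfer (auto simp: bounded_linear_Blinfun_apply bounded_linear_scaleC_blinfun)
  show "rmul (r *\<^sub>R M) = r *\<^sub>R rmul M"
    by (rule blinfun_eqI)
      (simp add: scaleR_multiplier_def * blinfun.scaleR_left flip: scaleR_scaleC)
qed (transfer, auto)+

instance
proof
  fix M N K :: "'a multiplier" and c d :: complex and r s :: real
  note ev = lmul_simps rmul_simps blinfun.add_left blinfun.diff_left blinfun.minus_left
    blinfun.add_right blinfun.scaleR_left lmul_scaleC
  show "M + N + K = M + (N + K)" "M + N = N + M" "0 + M = M" "- M + M = 0" "M - N = M + - N"
    by (rule multiplier_eqI, simp add: ev)+
  show "M * N * K = M * (N * K)" "(M + N) * K = M * K + N * K" "M * (N + K) = M * N + M * K"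
    by (rule multiplier_eqI, simp add: ev)+
  show "c *\<^sub>C (M + N) = c *\<^sub>C M + c *\<^sub>C N" "(c + d) *\<^sub>C M = c *\<^sub>C M + d *\<^sub>C M"
    "c *\<^sub>C d *\<^sub>C M = (c * d) *\<^sub>C M" "1 *\<^sub>C M = M" "r *\<^sub>R M = complex_of_real r *\<^sub>C M"
    by (rule multiplier_eqI,
        simp add: ev scaleC_add_right scaleC_add_left scaleC_scaleC scaleC_one scaleR_scaleC)+
  show "r *\<^sub>R (M + N) = r *\<^sub>R M + r *\<^sub>R N" "(r + s) *\<^sub>R M = r *\<^sub>R M + s *\<^sub>R M"
    "r *\<^sub>R s *\<^sub>R M = (r * s) *\<^sub>R M" "1 *\<^sub>R M = M"
    "r *\<^sub>R M * N = r *\<^sub>R (M * N)" "M * r *\<^sub>R N = r *\<^sub>R (M * N)"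
    by (rule multiplier_eqI, simp add: ev scaleR_add_right scaleR_add_left blinfun.scaleR_right)+
  show "sgn M = inverse (norm M) *\<^sub>R M" "dist M N = norm (M - N)"
    by (simp_all add: sgn_multiplier_def dist_multiplier_def)
  show "uniformity = (INF e\<in>{0<..}. principal {(M, N :: 'a multiplier). dist M N < e})"
    by (rule uniformity_multiplier_def)
  show "open U \<longleftrightarrow> (\<forall>M\<in>U. \<forall>\<^sub>F (M', N) in uniformity. M' = M \<longrightarrow> N \<in> U)"
    for U :: "'a multiplier set" by (rule open_multiplier_def)
  show "norm M = 0 \<longleftrightarrow> M = 0"
  proof
    assume "norm M = 0"
    then have "lmul M = 0" by (simp add: norm_multiplier_def)
    then show "M = 0" by (intro multiplier_eqI) (simp add: ev)
  qed (simp add: norm_multiplier_def ev)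
  show "norm (M + N) \<le> norm M + norm N"
    by (simp add: norm_multiplier_def ev norm_triangle_ineq)
  show "norm (r *\<^sub>R M) = \<bar>r\<bar> * norm M"
    by (simp add: norm_multiplier_def ev)
  show "norm (M * N) \<le> norm M * norm N"
    by (simp add: norm_multiplier_def ev norm_blinfun_compose)
  show "norm (c *\<^sub>C M) = cmod c * norm M"
  proof -
    have le: "norm (c *\<^sub>C M) \<le> cmod c * norm M" for c and M :: "'a multiplier"
      unfolding norm_multiplier_def
    proof (rule norm_blinfun_bound)
      show "norm (lmul (c *\<^sub>C M) x) \<le> cmod c * norm (lmul M) * norm x" for x
        using norm_blinfun[of "lmul M" x]
        by (simp add: ev norm_scaleC mult.assoc mult_left_mono)
    qed simp
    show ?thesis
    proof (cases "c = 0")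
      case True
      then show ?thesis using le[of 0 M]
        by (simp add: norm_multiplier_def)
    next
      case False
      have "inverse c *\<^sub>C c *\<^sub>C M = M"
        using False by (intro multiplier_eqI) (simp add: ev scaleC_scaleC scaleC_one)
      then have "cmod c * norm M \<le> norm (c *\<^sub>C M)"
        using le[of "inverse c" "c *\<^sub>C M"] False by (simp add: norm_divide field_simps)
      then show ?thesis using le[of c M] by simp
    qed
  qed
qed

end

instance multiplier :: (cstar_algebra) banach
proof
  fix X :: "nat \<Rightarrow> 'a multiplier"
  assume X: "Cauchy X"
  have nl: "dist (lmul M) (lmul N) = dist M N" and nr: "dist (rmul M) (rmul N) = dist M N"
    for M N :: "'a multiplier"
    using norm_lmul_rmul[of "M - N"]
    by (simp_all add: dist_norm norm_multiplier_def lmul_simps rmul_simps)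
  have "Cauchy (\<lambda>n. lmul (X n))" "Cauchy (\<lambda>n. rmul (X n))"
    using X by (simp_all add: Cauchy_def nl nr)
  then obtain l r where l: "(\<lambda>n. lmul (X n)) \<longlonglongrightarrow> l" and r: "(\<lambda>n. rmul (X n)) \<longlonglongrightarrow> r"
    by (meson Cauchy_convergent convergent_def)
  have lx: "(\<lambda>n. lmul (X n) x) \<longlonglongrightarrow> l x" and rx: "(\<lambda>n. rmul (X n) x) \<longlonglongrightarrow> r x" for x
    by (intro tendsto_intros l r)+
  have "l (c *\<^sub>C x) = c *\<^sub>C l x" for c x
    using LIMSEQ_unique[OF lx[of "c *\<^sub>C x"]] bounded_linear.tendsto[OF bounded_linear_scaleC lx[of x]]
    by (simp add: lmul_scaleC)
  moreover have "r (c *\<^sub>C x) = c *\<^sub>C r x" for c x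
    using LIMSEQ_unique[OF rx[of "c *\<^sub>C x"]] bounded_linear.tendsto[OF bounded_linear_scaleC rx[of x]]
    by (simp add: rmul_scaleC)
  moreover have "x * l y = r x * y" for x y
    using LIMSEQ_unique[OF tendsto_mult_left[OF lx[of y], of x]] tendsto_mult_right[OF rx[of x], of y]
    by (simp add: mult_lmul)
  ultimately have "lmul (Abs_multiplier (l, r)) = l"
    by (simp add: lmul.rep_eq Abs_multiplier_inverse)
  then have "dist (X n) (Abs_multiplier (l, r)) = dist (lmul (X n)) l" for n
    by (metis nl)
  then have "X \<longlonglongrightarrow> Abs_multiplier (l, r)"
    using l by (simp add: LIMSEQ_def)
  then show "convergent X" by (auto simp: convergent_def)
qed

instantiation multiplier :: (cstar_algebra) cstar_algebra
begin

lift_definition adj_multiplier :: "'a multiplier \<Rightarrow> 'a multiplier"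
  is "\<lambda>(l :: 'a \<Rightarrow>\<^sub>L 'a, r :: 'a \<Rightarrow>\<^sub>L 'a). (Blinfun (\<lambda>x. adj (r (adj x))), Blinfun (\<lambda>x. adj (l (adj x))))"
proof (clarsimp simp: bounded_linear_Blinfun_apply bounded_linear_adj_blinfun, intro conjI allI)
  fix l r :: "'a \<Rightarrow>\<^sub>L 'a" and c x y
  assume *: "\<forall>c x. l (c *\<^sub>C x) = c *\<^sub>C l x" "\<forall>c x. r (c *\<^sub>C x) = c *\<^sub>C r x"
    "\<forall>x y. x * l y = r x * y"
  show "adj (r (adj (c *\<^sub>C x))) = c *\<^sub>C adj (r (adj x))"
    "adj (l (adj (c *\<^sub>C x))) = c *\<^sub>C adj (l (adj x))"
    using * by (simp_all add: adj_scaleC)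
  show "x * adj (r (adj y)) = adj (l (adj x)) * y"
    using *(3)[rule_format, of "adj y" "adj x"]
    by (metis adj_adj adj_mult)
qed

lemma mul_adj:
  fixes M :: "'a multiplier"
  shows "lmul (adj M) x = adj (rmul M (adj x))" "rmul (adj M) x = adj (lmul M (adj x))"
  by (transfer, auto simp: bounded_linear_Blinfun_apply bounded_linear_adj_blinfun)+

instance
proof
  fix M N :: "'a multiplier" and c :: complex
  note ev = lmul_simps rmul_simps mul_adj blinfun.add_left lmul_scaleC
  show "(c *\<^sub>C M) * N = c *\<^sub>C (M * N)" "M * (c *\<^sub>C N) = c *\<^sub>C (M * N)"
    by (rule multiplier_eqI, simp add: ev)+
  show "adj (adj M) = M" "adj (M + N) = adj M + adj N" "adj (c *\<^sub>C M) = cnj c *\<^sub>C adj M"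
    "adj (M * N) = adj N * adj M"
    by (rule multiplier_eqI, simp add: ev adj_adj adj_add adj_scaleC)+
  show "norm (adj M * M) = (norm M)\<^sup>2"
  proof (rule antisym)
    have adj: "norm (adj M) \<le> norm M"
      unfolding norm_multiplier_def
    proof (rule norm_blinfun_bound)
      show "norm (lmul (adj M) x) \<le> norm (lmul M) * norm x" for x
        using norm_blinfun[of "rmul M" "adj x"] by (simp add: ev norm_adj norm_lmul_rmul)
    qed simp
    have "norm (adj M * M) \<le> norm (adj M) * norm M"
      by (simp add: norm_multiplier_def ev norm_blinfun_compose)
    also have "\<dots> \<le> norm M * norm M"
      using adj by (intro mult_right_mono) (simp_all add: norm_multiplier_def)
    finally show "norm (adj M * M) \<le> (norm M)\<^sup>2" by (simp add: power2_eq_square)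
  next
    have nonneg: "0 \<le> norm (adj M * M)" by (simp add: norm_multiplier_def)
    have "norm (lmul M x) \<le> sqrt (norm (adj M * M)) * norm x" for x
    proof -
      have "(norm (lmul M x))\<^sup>2 = norm (rmul M (adj (lmul M x)) * x)"
        by (simp add: mult_lmul flip: cstar_identity)
      also have "\<dots> = norm (adj (lmul (adj M * M) x) * x)"
        by (simp add: ev adj_adj)
      also have "\<dots> \<le> norm (adj M * M) * norm x * norm x"
        unfolding norm_multiplier_def
        by (rule order_trans[OF norm_mult_ineq])
          (intro mult_right_mono norm_ge_zero, simp only: norm_adj norm_blinfun)
      finally show ?thesis
        using nonneg by - (rule power2_le_imp_le,
          simp_all add: power_mult_distrib power2_eq_square[of "norm x"] mult.assoc)
    qed
    then have "norm M \<le> sqrt (norm (adj M * M))"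
      unfolding norm_multiplier_def[of M]
      by (intro norm_blinfun_bound) (simp_all add: norm_multiplier_def)
    then have "(norm M)\<^sup>2 \<le> (sqrt (norm (adj M * M)))\<^sup>2"
      by (intro power_mono) (simp_all add: norm_multiplier_def[of M])
    then show "(norm M)\<^sup>2 \<le> norm (adj M * M)"
      using nonneg by simp
  qed
qed

end

text \<open>The instance cannot be one of \<open>ring_1\<close>: if \<open>'a\<close> is the zero algebra, then \<open>0 = 1\<close>.\<close>

instantiation multiplier :: (cstar_algebra) monoid_mult
begin

lift_definition one_multiplier :: "'a multiplier" is "(id_blinfun, id_blinfun)"
  by simp

instance
proof
  fix M :: "'a multiplier"
  have "lmul 1 = (id_blinfun :: 'a \<Rightarrow>\<^sub>L 'a)" by transfer simp
  then show "1 * M = M" "M * 1 = M"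
    by (simp_all add: multiplier_eqI lmul_simps)
qed

end

text \<open>The canonical embedding of a C*-algebra into its multiplier algebra.\<close>

lift_definition embed :: "'a::cstar_algebra \<Rightarrow> 'a multiplier"
  is "\<lambda>a. (Blinfun (\<lambda>x. a * x), Blinfun (\<lambda>x. x * a))"
  by (simp add: bounded_linear_Blinfun_apply bounded_linear_mult_left bounded_linear_mult_right
      mult_scaleC_left mult_scaleC_right mult.assoc)

definition unitaries :: "'a::cstar_algebra multiplier set" where
  "unitaries = {u. adj u * u = 1 \<and> u * adj u = 1}"

text \<open>The locally convex topology given by the seminorms \<open>M \<mapsto> \<parallel>M b\<parallel> + \<parallel>b M\<parallel>\<close>.\<close>

definition strict_topology :: "'a::cstar_algebra multiplier topology" where
  "strict_topology = topology_generated_by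
     {{N. norm (lmul (N - M) b) + norm (rmul (N - M) b) < e} | M b e. 0 < e}"

definition nondegenerate_hom :: "('s::cstar_algebra \<Rightarrow> 'b::cstar_algebra multiplier) \<Rightarrow> bool" where
  "nondegenerate_hom \<phi> \<longleftrightarrow> closure (csubspace hull {lmul (\<phi> s) b | s b. True}) = UNIV"

definition extend_hom ::
  "('s::cstar_algebra \<Rightarrow> 'b::cstar_algebra multiplier) \<Rightarrow> 's multiplier \<Rightarrow> 'b multiplier" where
  "extend_hom \<phi> = (THE \<Phi>. star_hom \<Phi> \<and> \<Phi> 1 = 1 \<and>
     continuous_map strict_topology strict_topology \<Phi> \<and> (\<forall>s. \<Phi> (embed s) = \<phi> s))"


section \<open>Representations on Hilbert spaces\<close>

text \<open>HOL cannot quantify over all types of class \<^class>\<open>complex_hilbert\<close> inside a formula.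
  The Hilbert spaces over which the definitions below range are therefore the closed complex
  subspaces \<open>H\<close> (including the whole space) of an arbitrary ambient Hilbert space, which acts as
  a universe. Operators on
  \<open>H\<close> are functions with the value \<^term>\<open>undefined\<close> outside \<open>H\<close>, so that equality of functions
  is equality of operators.\<close>

definition hilbert_space :: "'h::complex_hilbert set \<Rightarrow> bool" where
  "hilbert_space H \<longleftrightarrow> closed H \<and> csubspace H"

definition bounded_ops :: "'h::complex_hilbert set \<Rightarrow> ('h \<Rightarrow> 'h) set" where
  "bounded_ops H = {T \<in> H \<rightarrow>\<^sub>E H.
     (\<forall>x\<in>H. \<forall>y\<in>H. T (x + y) = T x + T y) \<and> (\<forall>c. \<forall>x\<in>H. T (c *\<^sub>C x) = c *\<^sub>C T x) \<and>
     (\<exists>K. \<forall>x\<in>H. norm (T x) \<le> K * norm x)}"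

definition op_adj :: "'h::complex_hilbert set \<Rightarrow> ('h \<Rightarrow> 'h) \<Rightarrow> ('h \<Rightarrow> 'h)" where
  "op_adj H T = (THE S. S \<in> bounded_ops H \<and> (\<forall>x\<in>H. \<forall>y\<in>H. cinner (S x) y = cinner x (T y)))"

definition unitary_ops :: "'h::complex_hilbert set \<Rightarrow> ('h \<Rightarrow> 'h) set" where
  "unitary_ops H = {T \<in> bounded_ops H. T ` H = H \<and> (\<forall>x\<in>H. \<forall>y\<in>H. cinner (T x) (T y) = cinner x y)}"

definition representation ::
  "'h::complex_hilbert set \<Rightarrow> ('b::cstar_algebra \<Rightarrow> 'h \<Rightarrow> 'h) \<Rightarrow> bool" where
  "representation H \<pi> \<longleftrightarrow> (\<forall>a. \<pi> a \<in> bounded_ops H) \<and>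
     (\<forall>a b. \<forall>x\<in>H. \<pi> (a + b) x = \<pi> a x + \<pi> b x) \<and>
     (\<forall>c a. \<forall>x\<in>H. \<pi> (c *\<^sub>C a) x = c *\<^sub>C \<pi> a x) \<and>
     (\<forall>a b. \<forall>x\<in>H. \<pi> (a * b) x = \<pi> a (\<pi> b x)) \<and>
     (\<forall>a. \<forall>x\<in>H. \<forall>y\<in>H. cinner (\<pi> (adj a) x) y = cinner x (\<pi> a y))"

definition Rep :: "'h::complex_hilbert set \<Rightarrow> ('b::cstar_algebra \<Rightarrow> 'h \<Rightarrow> 'h) set" where
  "Rep H = {\<pi>. representation H \<pi> \<and>
     closure (csubspace hull {\<pi> b x | b x. x \<in> H}) = H}"

definition extend_rep ::
  "'h::complex_hilbert set \<Rightarrow> ('b::cstar_algebra \<Rightarrow> 'h \<Rightarrow> 'h) \<Rightarrow> 'b multiplier \<Rightarrow> 'h \<Rightarrow> 'h" where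
  "extend_rep H \<pi> = (THE \<sigma>. representation H \<sigma> \<and> (\<forall>b. \<sigma> (embed b) = \<pi> b))"

text \<open>The library writes topological groups additively, without assuming commutativity.\<close>

definition group_Rep ::
  "'h::complex_hilbert set \<Rightarrow> ('g::topological_group_add \<Rightarrow> 'h \<Rightarrow> 'h) set" where
  "group_Rep H = {U. (\<forall>g. U g \<in> unitary_ops H) \<and>
     (\<forall>g h. \<forall>x\<in>H. U (g + h) x = U g (U h x)) \<and>
     (\<forall>x\<in>H. continuous_on UNIV (\<lambda>g. U g x))}"


section \<open>Host algebras and crossed product hosts\<close>

definition eta_star ::
  "'h::complex_hilbert set \<Rightarrow> ('g::topological_group_add \<Rightarrow> 'l::cstar_algebra multiplier) \<Rightarrow>
    ('l \<Rightarrow> 'h \<Rightarrow> 'h) \<Rightarrow> 'g \<Rightarrow> 'h \<Rightarrow> 'h" where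
  "eta_star H \<eta> \<pi> = extend_rep H \<pi> \<circ> \<eta>"

definition host_algebra ::
  "'h::complex_hilbert itself \<Rightarrow> ('g::topological_group_add \<Rightarrow> 'l::cstar_algebra multiplier) \<Rightarrow> bool"
  where
  "host_algebra _ \<eta> \<longleftrightarrow>
     range \<eta> \<subseteq> unitaries \<and> (\<forall>g h. \<eta> (g + h) = \<eta> g * \<eta> h) \<and>
     (\<forall>H :: 'h set. hilbert_space H \<longrightarrow> (\<forall>\<pi>\<in>Rep H. eta_star H \<eta> \<pi> \<in> group_Rep H)) \<and>
     (\<forall>H :: 'h set. hilbert_space H \<longrightarrow> inj_on (eta_star H \<eta>) (Rep H))"

text \<open>The representation \<open>U\<^sub>L\<close> of the host algebra that belongs to \<open>U\<close>.\<close>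

definition host_rep ::
  "'h::complex_hilbert set \<Rightarrow> ('g::topological_group_add \<Rightarrow> 'l::cstar_algebra multiplier) \<Rightarrow>
    ('g \<Rightarrow> 'h \<Rightarrow> 'h) \<Rightarrow> 'l \<Rightarrow> 'h \<Rightarrow> 'h" where
  "host_rep H \<eta> = inv_into (Rep H) (eta_star H \<eta>)"

definition cstar_action ::
  "('g::topological_group_add \<Rightarrow> 'a::cstar_algebra \<Rightarrow> 'a) \<Rightarrow> bool" where
  "cstar_action \<alpha> \<longleftrightarrow> (\<forall>g. star_hom (\<alpha> g) \<and> bij (\<alpha> g)) \<and> (\<forall>g h. \<alpha> (g + h) = \<alpha> g \<circ> \<alpha> h)"

definition cov_Rep ::
  "'h::complex_hilbert set \<Rightarrow> ('g::topological_group_add \<Rightarrow> 'a::cstar_algebra \<Rightarrow> 'a) \<Rightarrow>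
    (('a \<Rightarrow> 'h \<Rightarrow> 'h) \<times> ('g \<Rightarrow> 'h \<Rightarrow> 'h)) set" where
  "cov_Rep H \<alpha> = {(\<pi>, U). \<pi> \<in> Rep H \<and> U \<in> group_Rep H \<and>
     (\<forall>g a. \<forall>x\<in>H. U g (\<pi> a (op_adj H (U g) x)) = \<pi> (\<alpha> g a) x)}"

definition cov_Rep_host ::
  "'h::complex_hilbert set \<Rightarrow> ('g::topological_group_add \<Rightarrow> 'a::cstar_algebra \<Rightarrow> 'a) \<Rightarrow>
    ('g \<Rightarrow> 'l::cstar_algebra multiplier) \<Rightarrow> (('a \<Rightarrow> 'h \<Rightarrow> 'h) \<times> ('g \<Rightarrow> 'h \<Rightarrow> 'h)) set" where
  "cov_Rep_host H \<alpha> \<eta> = {(\<pi>, U) \<in> cov_Rep H \<alpha>. U \<in> eta_star H \<eta> ` Rep H}"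

definition crossed_product_host ::
  "('g::topological_group_add \<Rightarrow> 'a::cstar_algebra \<Rightarrow> 'a) \<Rightarrow> ('g \<Rightarrow> 'l::cstar_algebra multiplier) \<Rightarrow>
    ('a \<Rightarrow> 'c::cstar_algebra multiplier) \<Rightarrow> ('l \<Rightarrow> 'c multiplier) \<Rightarrow> bool" where
  "crossed_product_host \<alpha> \<eta> \<eta>A \<eta>L \<longleftrightarrow>
     star_hom \<eta>A \<and> star_hom \<eta>L \<and>
     nondegenerate_hom \<eta>L \<and>
     (\<forall>g a. extend_hom \<eta>L (\<eta> g) * \<eta>A a * adj (extend_hom \<eta>L (\<eta> g)) = \<eta>A (\<alpha> g a)) \<and>
     {\<eta>A a * \<eta>L l | a l. True} \<subseteq> range embed \<and>
     cstar_subalgebra hull {c. \<exists>a l. embed c = \<eta>A a * \<eta>L l} = UNIV"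

text \<open>In the last clause \<open>c\<close> is the element of the crossed product host that the product in the
  multiplier algebra represents; \<open>\<rho>\<close> is not required to be non-degenerate.\<close>

definition full_crossed_product_host ::
  "'h::complex_hilbert itself \<Rightarrow> ('g::topological_group_add \<Rightarrow> 'a::cstar_algebra \<Rightarrow> 'a) \<Rightarrow>
    ('g \<Rightarrow> 'l::cstar_algebra multiplier) \<Rightarrow>
    ('a \<Rightarrow> 'c::cstar_algebra multiplier) \<Rightarrow> ('l \<Rightarrow> 'c multiplier) \<Rightarrow> bool" where
  "full_crossed_product_host _ \<alpha> \<eta> \<eta>A \<eta>L \<longleftrightarrow> crossed_product_host \<alpha> \<eta> \<eta>A \<eta>L \<and>
     (\<forall>H :: 'h set. hilbert_space H \<longrightarrow> (\<forall>(\<pi>, U) \<in> cov_Rep_host H \<alpha> \<eta>.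
        \<exists>!\<rho>. representation H \<rho> \<and>
          (\<forall>a l c. embed c = \<eta>A a * \<eta>L l \<longrightarrow> (\<forall>x\<in>H. \<rho> c x = \<pi> a (host_rep H \<eta> U l x)))))"

definition eta_G ::
  "('g::topological_group_add \<Rightarrow> 'l::cstar_algebra multiplier) \<Rightarrow>
    ('l \<Rightarrow> 'c::cstar_algebra multiplier) \<Rightarrow> 'g \<Rightarrow> 'c multiplier" where
  "eta_G \<eta> \<eta>L = extend_hom \<eta>L \<circ> \<eta>"

definition eta_times_star ::
  "'h::complex_hilbert set \<Rightarrow> ('g::topological_group_add \<Rightarrow> 'l::cstar_algebra multiplier) \<Rightarrow>
    ('a::cstar_algebra \<Rightarrow> 'c::cstar_algebra multiplier) \<Rightarrow> ('l \<Rightarrow> 'c multiplier) \<Rightarrow>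
    ('c \<Rightarrow> 'h \<Rightarrow> 'h) \<Rightarrow> ('a \<Rightarrow> 'h \<Rightarrow> 'h) \<times> ('g \<Rightarrow> 'h \<Rightarrow> 'h)" where
  "eta_times_star H \<eta> \<eta>A \<eta>L \<rho> = (extend_rep H \<rho> \<circ> \<eta>A, extend_rep H \<rho> \<circ> eta_G \<eta> \<eta>L)"

end

theory Submission
  imports Defs
begin

text \<open>
  Write \<open>\<sigma>\<close> for the extension of \<open>\<rho> \<in> Rep(\<C>, \<H>)\<close> to multipliers, \<open>\<pi> = \<sigma> \<circ> \<eta>\<^sub>A\<close>, \<open>\<mu> = \<sigma> \<circ> \<eta>\<^sub>L\<close>, and
  let \<open>U\<close> be the composition of \<open>\<sigma>\<close> with \<open>\<eta>\<^sub>G\<close>. By uniqueness of extensions \<open>U = \<eta>\<^sup>*(\<mu>)\<close>, so \<open>U\<close> is an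
  \<open>\<L>\<close>-representation, and it determines \<open>\<mu>\<close> because \<open>\<eta>\<^sup>*\<close> is injective. The covariance of
  \<open>(\<pi>, U)\<close> is the covariance of \<open>(\<eta>\<^sub>A, \<eta>\<^sub>G)\<close>. Since \<open>\<rho>\<close> takes the generators
  \<open>\<eta>\<^sub>A(a) \<eta>\<^sub>L(l)\<close> of \<open>\<C>\<close> to \<open>\<pi>(a) \<mu>(l)\<close>, it is determined by \<open>\<pi>\<close> and \<open>\<mu>\<close>, hence by \<open>(\<pi>, U)\<close>; this is
  \<open>inj_eta_times_star\<close>.

  The delicate point is that \<open>\<pi>\<close> is nondegenerate (\<open>\<pi>_Rep\<close>). The closed span \<open>N\<close> of \<open>\<pi>(\<A>)\<H>\<close> is
  invariant under \<open>U\<close> by covariance, but the adjoint generators \<open>\<mu>(l) \<pi>(a)\<close> map into \<open>N\<close> only if \<open>N\<close> is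
  invariant under \<open>\<mu>\<close> too. This again follows from injectivity of \<open>\<eta>\<^sup>*\<close>, applied to \<open>\<mu>\<close> and its
  conjugate by the reflection in \<open>N\<close> (\<open>host_rep_invariant_subspace\<close>).

  For a full host, a covariant \<open>\<L>\<close>-representation \<open>(\<pi>, U)\<close> with \<open>U = \<eta>\<^sup>*(\<mu>)\<close> yields \<open>\<rho>\<close> with
  \<open>\<rho>(\<eta>\<^sub>A(a) \<eta>\<^sub>L(l)) = \<pi>(a) \<mu>(l)\<close>. Nondegeneracy of \<open>\<pi>\<close> and \<open>\<mu>\<close> makes \<open>\<rho>\<close> nondegenerate, and it allows
  one to separate the two factors and to conclude that the image of \<open>\<rho>\<close> is \<open>(\<pi>, U)\<close>
  (\<open>full_crossed_product_host_surj\<close>).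

  All of this rests on the existence of the extensions to multiplier algebras. Representations and
  nondegenerate morphisms are treated together as nondegenerate Banach modules over a C*-algebra.
  Cohen's factorization theorem writes every vector exactly as \<open>x = T l y\<close>, so that a multiplier \<open>M\<close>
  must act by \<open>T (M l) y\<close>, and exact factorization also yields strict continuity.
  Its proof needs bounded approximate units, and these, as well as the contractivity of
  *-homomorphisms and representations, come from a single elementary tool that stands in for spectral theory:
  for a self-adjoint \<open>h\<close> with \<open>\<parallel>h\<parallel> < 1\<close>, the element \<open>1 - h\<close> has a self-adjoint square root in the unitization
  (\<open>ex_sqrt_one_minus\<close>).
\<close>

section \<open>Complex scalars and *-homomorphisms\<close>

lemma scaleC_zero_left: "0 *\<^sub>C x = (0 :: 'a::complex_vector)"
  using scaleC_add_left[of 0 0 x] by simp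

lemma scaleC_minus_left: "(- c) *\<^sub>C x = - (c *\<^sub>C x :: 'a::complex_vector)"
  using scaleC_add_left[of c "- c" x] by (simp add: scaleC_zero_left eq_neg_iff_add_eq_0 add.commute)

lemma scaleC_minus_one: "(- 1) *\<^sub>C x = - (x :: 'a::complex_vector)"
  by (simp add: scaleC_minus_left scaleC_one)

lemma adj_zero: "adj 0 = (0 :: 'a::cstar_algebra)"
  using norm_adj[of "0 :: 'a"] by simp

lemma adj_diff: "adj (x - y) = adj x - (adj y :: 'a::cstar_algebra)"
  using adj_add[of "x - y" y] by simp

lemma adj_one: "adj 1 = (1 :: 'a::cstar_algebra multiplier)"
  by (metis adj_adj adj_mult mult.left_neutral mult.right_neutral)

lemma lmul_one: "lmul 1 x = x"
  by transfer simp

lemma norm_lmul: "norm (lmul M x) \<le> norm M * norm x"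
  by (simp add: norm_multiplier_def norm_blinfun)

lemma norm_multiplier_le:
  assumes "\<And>x. norm (lmul M x) \<le> K * norm x" "0 \<le> K" shows "norm M \<le> K"
  unfolding norm_multiplier_def by (rule norm_blinfun_bound) (use assms in auto)

lemma norm_one_multiplier: "norm (1 :: 'a::cstar_algebra multiplier) \<le> 1"
  by (rule norm_multiplier_le) (simp_all add: lmul_one)

lemma lmul_embed: "lmul (embed a) x = a * x"
  by transfer (simp add: bounded_linear_Blinfun_apply bounded_linear_mult_right)

lemma rmul_embed: "rmul (embed a) x = x * a"
  by transfer (simp add: bounded_linear_Blinfun_apply bounded_linear_mult_left)

lemma star_hom_embed: "star_hom embed"
  unfolding star_hom_def
  by (auto intro!: multiplier_eqI simp: lmul_simps lmul_embed rmul_embed mul_adj blinfun.add_left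
      distrib_right mult_scaleC_left mult.assoc adj_mult adj_adj)

lemma mult_embed: "M * embed a = embed (lmul M a)"
  by (rule multiplier_eqI) (simp add: lmul_simps lmul_embed lmul_mult)

lemma
  assumes "star_hom f"
  shows star_hom_add: "f (x + y) = f x + f y"
    and star_hom_scaleC: "f (c *\<^sub>C x) = c *\<^sub>C f x"
    and star_hom_mult: "f (x * y) = f x * f y"
    and star_hom_adj: "f (adj x) = adj (f x)"
  using assms by (simp_all add: star_hom_def)

lemma
  assumes "star_hom f"
  shows star_hom_diff: "f (x - y) = f x - f y"
    and star_hom_scaleR: "f (r *\<^sub>R x) = r *\<^sub>R f x"
    and star_hom_zero: "f 0 = 0"
proof -
  have minus: "f (- x) = - f x" for x
    using star_hom_scaleC[OF assms, of "- 1" x] by (simp add: scaleC_minus_one)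
  show "f (x - y) = f x - f y"
    using star_hom_add[OF assms, of x "- y"] by (simp add: minus)
  show "f (r *\<^sub>R x) = r *\<^sub>R f x" by (simp add: scaleR_scaleC star_hom_scaleC[OF assms])
  show "f 0 = 0" using star_hom_scaleC[OF assms, of 0 0] by (simp add: scaleC_zero_left)
qed

section \<open>Square roots in the unitization\<close>

text \<open>The equation for \<open>c\<close> says that \<open>1 - c\<close> is a square root of \<open>1 - h\<close>. It is solved by the fixed
  point of \<open>c \<mapsto> (h + c\<^sup>2) / 2\<close>, which contracts the ball of radius \<open>1 - sqrt (1 - \<parallel>h\<parallel>)\<close>.
  Self-adjointness and commutation with the commutant of \<open>h\<close> are closed conditions preserved
  by this map, so they pass to the fixed point.\<close>

lemma ex_sqrt_one_minus:
  fixes h :: "'a::cstar_algebra"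
  assumes "adj h = h" "norm h < 1"
  obtains c where "adj c = c" "\<And>k. h * k = k * h \<Longrightarrow> c * k = k * c" "c + c - c * c = h"
proof -
  define r where "r = 1 - sqrt (1 - norm h)"
  have s: "0 < sqrt (1 - norm h)" "sqrt (1 - norm h) \<le> 1"
    using assms(2) by simp_all
  have r: "0 \<le> r" "r < 1" using s by (simp_all add: r_def)
  have "(sqrt (1 - norm h))\<^sup>2 = 1 - norm h" using assms(2) by simp
  then have r2: "norm h + r * r = r + r"
    by (simp add: r_def power2_eq_square algebra_simps)
  define f where "f c = (1/2) *\<^sub>R (h + c * c)" for c
  define S where "S = {c. adj c = c} \<inter> {c. \<forall>k. h * k = k * h \<longrightarrow> c * k = k * c} \<inter> cball 0 r"
  have "\<exists>!c\<in>S. f c = c"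
  proof (rule Banach_fix[OF _ _ r])
    have "closed {c :: 'a. adj c = c}"
      by (intro closed_Collect_eq continuous_intros bounded_linear.continuous_on[OF bounded_linear_adj])
    moreover have "closed {c :: 'a. \<forall>k. h * k = k * h \<longrightarrow> c * k = k * c}"
      by (intro closed_Collect_all closed_Collect_imp closed_Collect_eq continuous_intros) simp
    ultimately show "complete S"
      unfolding S_def complete_eq_closed by (intro closed_Int closed_cball)
    show "S \<noteq> {}"
    proof -
      have "0 \<in> S" using r by (simp add: S_def adj_zero)
      then show ?thesis by blast
    qed
    show "f ` S \<subseteq> S"
    proof clarify
      fix c assume "c \<in> S"
      then have c: "adj c = c" "\<And>k. h * k = k * h \<Longrightarrow> c * k = k * c" "norm c \<le> r"
        by (auto simp: S_def)
      have "norm (h + c * c) \<le> norm h + norm (c * c)" by (rule norm_triangle_ineq)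
      also have "\<dots> \<le> norm h + r * r"
        using order_trans[OF norm_mult_ineq mult_mono[OF c(3) c(3) r(1) norm_ge_zero]] by simp
      finally have "norm (f c) \<le> r" by (simp add: f_def r2)
      moreover have "f c * k = k * f c" if "h * k = k * h" for k
      proof -
        have "c * c * k = k * (c * c)" using c(2)[OF that] by (metis mult.assoc)
        then show ?thesis using that by (simp add: f_def distrib_left distrib_right)
      qed
      moreover have "adj (f c) = f c"
        by (simp add: f_def adj_scaleR adj_add adj_mult assms(1) c(1))
      ultimately show "f c \<in> S" by (auto simp: S_def)
    qed
    show "dist (f c) (f d) \<le> r * dist c d" if "c \<in> S" "d \<in> S" for c d
    proof -
      have n: "norm c \<le> r" "norm d \<le> r" using that by (auto simp: S_def)
      have "f c - f d = (1/2) *\<^sub>R (c * (c - d) + (c - d) * d)"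
        by (simp add: f_def algebra_simps)
      then have "dist (f c) (f d) \<le> (norm c * norm (c - d) + norm (c - d) * norm d) / 2"
        using norm_triangle_ineq[of "c * (c - d)" "(c - d) * d"] norm_mult_ineq[of c "c - d"]
          norm_mult_ineq[of "c - d" d] by (simp add: dist_norm)
      also have "\<dots> \<le> (r * norm (c - d) + norm (c - d) * r) / 2"
        using n by (intro divide_right_mono add_mono mult_right_mono mult_left_mono) auto
      finally show ?thesis by (simp add: dist_norm)
    qed
  qed
  then obtain c where c: "c \<in> S" "f c = c" by blast
  have "2 *\<^sub>R f c = 2 *\<^sub>R c" using c(2) by simp
  then have "c + c - c * c = h" by (simp add: f_def scaleR_2 algebra_simps)
  moreover have "adj c = c" "\<And>k. h * k = k * h \<Longrightarrow> c * k = k * c"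
    using c(1) by (simp_all add: S_def)
  ultimately show ?thesis by (rule that[rotated 2])
qed

text \<open>The element \<open>p + \<i> q\<close> is unitary and \<open>p\<close> is its real part.\<close>

lemma norm_le_one_if_squares_sum_to_one:
  fixes p q :: "'a::cstar_algebra multiplier"
  assumes "adj p = p" "adj q = q" "p * q = q * p" "p * p + q * q = 1"
  shows "norm p \<le> 1"
proof -
  define u where "u = p + \<i> *\<^sub>C q"
  have adju: "adj u = p - \<i> *\<^sub>C q"
    by (simp add: u_def adj_add adj_scaleC assms(1,2) scaleC_minus_left)
  have "adj u * u = p * p + q * q"
    unfolding adju unfolding u_def
    by (simp add: left_diff_distrib distrib_left mult_scaleC_left mult_scaleC_right
        scaleC_scaleC scaleC_minus_one scaleC_add_right scaleC_diff_right assms(3))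
  then have "(norm u)\<^sup>2 \<le> 1"
    using norm_one_multiplier by (metis assms(4) cstar_identity)
  then have u: "norm u \<le> 1" by (simp add: power2_le_iff_abs_le abs_square_le_1)
  have "p = (1/2) *\<^sub>R (u + adj u)"
    unfolding adju by (simp add: u_def flip: scaleR_2)
  then have "norm p = norm (u + adj u) / 2" by simp
  also have "\<dots> \<le> (norm u + norm (adj u)) / 2"
    by (intro divide_right_mono norm_triangle_ineq) simp
  also have "\<dots> \<le> 1" using u by (simp add: norm_adj)
  finally show ?thesis .
qed

text \<open>A self-adjoint \<open>h\<close> with \<open>\<parallel>h\<parallel> < 1\<close> and the square root \<open>1 - c\<close> of \<open>1 - h\<^sup>2\<close> are the real and the
  imaginary part of a unitary. This relation is purely algebraic, so that a *-homomorphism preserves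
  it, and the images are again bounded by one. The usual argument through the spectral radius
  needs the spectral theory of \<open>h\<close>; this one needs only the square root.\<close>

lemma ex_unitary_parts:
  fixes h :: "'a::cstar_algebra"
  assumes "adj h = h" "norm h < 1"
  obtains c where "c + c - c * c = h * h"
    "\<And>f :: 'a \<Rightarrow> 'b::cstar_algebra multiplier. star_hom f \<Longrightarrow> norm (f h) \<le> 1 \<and> norm (1 - f c) \<le> 1"
proof -
  have "norm (h * h) < 1"
    using norm_mult_ineq[of h h] assms(2) mult_strict_mono[of "norm h" 1 "norm h" 1] by simp
  then obtain c where c: "adj c = c" "\<And>k. h * h * k = k * (h * h) \<Longrightarrow> c * k = k * c"
    "c + c - c * c = h * h"
    using ex_sqrt_one_minus[of "h * h"] assms(1) by (metis adj_mult)
  have hc: "c * h = h * c" by (rule c(2)) (simp add: mult.assoc)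
  have "norm (f h) \<le> 1 \<and> norm (1 - f c) \<le> 1" if f: "star_hom f" for f :: "'a \<Rightarrow> 'b multiplier"
  proof -
    have adj: "adj (f h) = f h" "adj (1 - f c) = 1 - f c"
      using assms(1) c(1) by (simp_all add: adj_diff adj_one flip: star_hom_adj[OF f])
    have comm: "f h * (1 - f c) = (1 - f c) * f h"
      using hc by (simp add: algebra_simps flip: star_hom_mult[OF f])
    have "f h * f h = f c + f c - f c * f c"
      by (simp flip: star_hom_mult[OF f] star_hom_add[OF f] star_hom_diff[OF f] c(3))
    then have sum: "f h * f h + (1 - f c) * (1 - f c) = 1"
      by (simp add: algebra_simps)
    show ?thesis
      using norm_le_one_if_squares_sum_to_one[OF adj comm sum]
        norm_le_one_if_squares_sum_to_one[OF adj(2,1) comm[symmetric]] sum by (simp add: add.commute)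
  qed
  with that c(3) show ?thesis by blast
qed

text \<open>A homogeneous function is controlled by its values on the open unit ball, which is where
  the square roots exist.\<close>

lemma norm_le_by_strict_scaling:
  fixes T :: "'a::real_normed_vector \<Rightarrow> real"
  assumes "\<And>r. T (r *\<^sub>R x) = \<bar>r\<bar> * T x" "\<And>r. norm (r *\<^sub>R x) < 1 \<Longrightarrow> T (r *\<^sub>R x) \<le> K"
  shows "T x \<le> K * norm x"
proof (cases "x = 0")
  case True
  then show ?thesis using assms(1)[of 0] by simp
next
  case False
  have "T x \<le> K * s" if s: "norm x < s" for s
  proof -
    have "0 < s" using s norm_ge_zero[of x] by linarith
    then have "T ((1 / s) *\<^sub>R x) \<le> K" using s by (intro assms(2)) simp
    then show ?thesis using \<open>0 < s\<close> by (simp add: assms(1) field_simps)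
  qed
  moreover have "((\<lambda>s. K * s) \<longlongrightarrow> K * norm x) (at_right (norm x))"
    by (intro tendsto_intros)
  ultimately show ?thesis
    by (intro tendsto_lowerbound[where F = "at_right (norm x)"])
      (auto simp: eventually_at_right_less intro: eventually_mono[OF eventually_at_right_less])
qed

lemma norm_star_hom_le:
  fixes f :: "'a::cstar_algebra \<Rightarrow> 'b::cstar_algebra multiplier"
  assumes f: "star_hom f"
  shows "norm (f a) \<le> norm a"
proof -
  have self_adjoint: "norm (f h) \<le> 1 * norm h" if "adj h = h" for h
  proof (rule norm_le_by_strict_scaling[where T = "\<lambda>x. norm (f x)"])
    show "norm (f (r *\<^sub>R h)) \<le> 1" if "norm (r *\<^sub>R h) < 1" for r
      using ex_unitary_parts[of "r *\<^sub>R h", where 'b = 'b] that \<open>adj h = h\<close> f by (metis adj_scaleR)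
  qed (simp add: star_hom_scaleR[OF f])
  have "(norm (f a))\<^sup>2 = norm (f (adj a * a))"
    by (simp add: star_hom_mult[OF f] star_hom_adj[OF f] cstar_identity)
  also have "\<dots> \<le> (norm a)\<^sup>2"
    using self_adjoint[of "adj a * a"] by (simp add: adj_mult adj_adj cstar_identity)
  finally show ?thesis by (simp add: power2_le_iff_abs_le)
qed

section \<open>Bounded approximate units\<close>

lemma norm_rmul: "norm (rmul M x) \<le> norm M * norm x"
  by (simp add: norm_multiplier_def norm_lmul_rmul norm_blinfun)

lemma norm_embed: "norm (embed a) = norm a"
proof (rule antisym)
  show "norm (embed a) \<le> norm a"
    by (rule norm_multiplier_le) (simp_all add: lmul_embed norm_mult_ineq)
  show "norm a \<le> norm (embed a)"
  proof (cases "a = 0")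
    case False
    have "norm a * norm a \<le> norm (embed a) * norm a"
      using norm_lmul[of "embed a" "adj a"]
      by (simp add: lmul_embed norm_cstar_right norm_adj power2_eq_square)
    then show ?thesis using False by simp
  qed simp
qed

text \<open>The condition \<open>\<parallel>1 - e\<parallel> \<le> 1\<close> takes the place of positivity in the choice of approximate units. The
  complements \<open>1 - e\<close> of these \<open>e\<close> form a multiplicative semigroup, so that a unit for finitely many
  elements can be composed from units for single elements.\<close>

definition unit_defects :: "'a::cstar_algebra multiplier set" where
  "unit_defects = {X. norm X \<le> 1 \<and> (\<exists>e. X = 1 - embed e)}"

lemma one_in_unit_defects: "1 \<in> unit_defects"
proof -
  have "1 = 1 - embed 0" by (simp add: star_hom_zero[OF star_hom_embed])
  then show ?thesis unfolding unit_defects_def using norm_one_multiplier by blast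
qed

lemma mult_in_unit_defects:
  assumes "X \<in> unit_defects" "Y \<in> unit_defects" shows "X * Y \<in> unit_defects"
proof -
  obtain e d where ed: "X = 1 - embed e" "Y = 1 - embed d"
    using assms by (auto simp: unit_defects_def)
  have "X * Y = 1 - embed (e + d - e * d)"
    by (simp add: ed algebra_simps star_hom_add[OF star_hom_embed] star_hom_diff[OF star_hom_embed]
        star_hom_mult[OF star_hom_embed])
  moreover have "norm (X * Y) \<le> 1"
    using norm_mult_ineq[of X Y] mult_mono[of "norm X" 1 "norm Y" 1] assms
    by (simp add: unit_defects_def)
  ultimately show ?thesis by (auto simp: unit_defects_def)
qed

lemma power_in_unit_defects: "X \<in> unit_defects \<Longrightarrow> X ^ n \<in> unit_defects"
  by (induction n) (simp_all add: one_in_unit_defects mult_in_unit_defects)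

text \<open>The witness is the mean of \<open>1, A, \<dots>, A\<^bsup>n-1\<^esup>\<close>: convex combinations preserve the set, and multiplication
  by \<open>1 - A\<close> telescopes the sum to \<open>1 - A\<^sup>n\<close>, whose norm is at most two.\<close>

lemma ex_cesaro_mean:
  assumes A: "A \<in> unit_defects" and n: "0 < n"
  obtains X where "X \<in> unit_defects" "norm (X * (1 - A)) \<le> 2 / real n"
proof -
  have "\<exists>S. norm S \<le> real n \<and> (\<exists>d. S = real n *\<^sub>R 1 - embed d) \<and> S * (1 - A) = 1 - A ^ n" for n
  proof (induction n)
    case 0
    show ?case
      by (rule exI[of _ 0]) (auto intro!: exI[of _ 0] simp: star_hom_zero[OF star_hom_embed])
  next
    case (Suc n)
    then obtain S d where S: "norm S \<le> real n" "S = real n *\<^sub>R 1 - embed d" "S * (1 - A) = 1 - A ^ n"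
      by blast
    obtain e where e: "A ^ n = 1 - embed e" "norm (A ^ n) \<le> 1"
      using power_in_unit_defects[OF A, of n] by (auto simp: unit_defects_def)
    have "norm (S + A ^ n) \<le> real (Suc n)"
      using norm_triangle_ineq[of S "A ^ n"] S(1) e(2) by simp
    moreover have "S + A ^ n = real (Suc n) *\<^sub>R 1 - embed (d + e)"
      by (simp add: S(2) e(1) star_hom_add[OF star_hom_embed] algebra_simps)
    moreover have "(S + A ^ n) * (1 - A) = 1 - A ^ Suc n"
    proof -
      have "A ^ n * (1 - A) = A ^ n - A ^ Suc n"
        by (simp only: right_diff_distrib mult.right_neutral power_Suc2)
      then show ?thesis by (simp only: distrib_right S(3)) simp
    qed
    ultimately show ?case by blast
  qed
  then obtain S d where S: "norm S \<le> real n" "S = real n *\<^sub>R 1 - embed d" "S * (1 - A) = 1 - A ^ n"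
    by blast
  define X where "X = (1 / real n) *\<^sub>R S"
  have "X = 1 - embed ((1 / real n) *\<^sub>R d)"
    using n by (simp add: X_def S(2) scaleR_diff_right star_hom_scaleR[OF star_hom_embed])
  moreover have "norm X \<le> 1" using n S(1) by (simp add: X_def field_simps)
  moreover have "norm (X * (1 - A)) \<le> 2 / real n"
  proof -
    have "norm (1 - A ^ n) \<le> norm (1 :: 'a multiplier) + norm (A ^ n)" by (rule norm_triangle_ineq4)
    also have "\<dots> \<le> 2"
      using norm_one_multiplier[where 'a = 'a] power_in_unit_defects[OF A, of n]
      by (simp add: unit_defects_def)
    finally show ?thesis using n by (simp add: X_def S(3) divide_right_mono)
  qed
  ultimately show ?thesis using that by (auto simp: unit_defects_def)
qed

lemma norm_lmul_square_le:
  assumes "norm X \<le> 1"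
  shows "(norm (lmul X l))\<^sup>2 \<le> norm (lmul X (l * adj l))"
proof -
  have "adj (lmul X l) = rmul (adj X) (adj l)" by (simp add: mul_adj adj_adj)
  then have "(norm (lmul X l))\<^sup>2 = norm (rmul (adj X) (lmul X (l * adj l)))"
    by (simp add: norm_cstar_right[symmetric] lmul_mult rmul_mult)
  also have "\<dots> \<le> norm (adj X) * norm (lmul X (l * adj l))" by (rule norm_rmul)
  also have "\<dots> \<le> 1 * norm (lmul X (l * adj l))"
    using assms by (intro mult_right_mono) (simp_all add: norm_adj)
  finally show ?thesis by simp
qed

text \<open>For \<open>h\<close> a multiple of \<open>l l\<^sup>*\<close> of norm below one, \<open>A = 1 - h\<^sup>2\<close> is the square of a contraction
  \<open>1 - c\<close>. The means \<open>X\<close> of its powers make \<open>X (1 - A) = X h\<^sup>2\<close> small, and two applications of the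
  C*-identity pass from \<open>h\<^sup>2\<close> to \<open>h\<close> and from \<open>l l\<^sup>*\<close> to \<open>l\<close>.\<close>

lemma ex_unit_defect:
  fixes l :: "'a::cstar_algebra"
  assumes "0 < \<epsilon>"
  obtains X where "X \<in> unit_defects" "norm (lmul X l) < \<epsilon>"
proof -
  define t where "t = 1 / ((norm l)\<^sup>2 + 1)"
  have pos: "0 < (norm l)\<^sup>2 + 1" by (simp add: add_nonneg_pos)
  then have t: "0 < t" by (simp add: t_def)
  define h where "h = t *\<^sub>R (l * adj l)"
  have h: "adj h = h" "norm h < 1"
    using pos by (simp_all add: h_def adj_scaleR adj_mult adj_adj norm_cstar_right t_def)
  obtain c where c: "c + c - c * c = h * h"
    "\<And>f :: 'a \<Rightarrow> 'a multiplier. star_hom f \<Longrightarrow> norm (f h) \<le> 1 \<and> norm (1 - f c) \<le> 1"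
    using ex_unitary_parts[OF h] by metis
  define A where "A = (1 - embed c) * (1 - embed c)"
  have "A = 1 - embed (c + c - c * c)"
    by (simp add: A_def algebra_simps star_hom_add[OF star_hom_embed] star_hom_diff[OF star_hom_embed]
        star_hom_mult[OF star_hom_embed])
  then have A1: "1 - A = embed (h * h)" by (simp add: c(1))
  have A: "A \<in> unit_defects"
    unfolding A_def using c(2)[OF star_hom_embed]
    by (intro mult_in_unit_defects) (auto simp: unit_defects_def)
  \<comment> \<open>the bound on \<open>\<parallel>X h\<parallel>\<close> that gives \<open>\<parallel>X l\<parallel>\<^sup>2 \<le> \<parallel>X l l\<^sup>*\<parallel> = \<parallel>X h\<parallel> / t < \<epsilon>\<^sup>2\<close>\<close>
  define \<delta> where "\<delta> = t * \<epsilon>\<^sup>2"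
  have \<delta>: "0 < \<delta>" using t assms by (simp add: \<delta>_def)
  obtain n where n: "2 / \<delta>\<^sup>2 < real n" using reals_Archimedean2 by blast
  have "0 < 2 / \<delta>\<^sup>2" using \<delta> by simp
  with n have n0: "0 < n" by (metis less_trans of_nat_0_less_iff)
  obtain X where X: "X \<in> unit_defects" "norm (X * (1 - A)) \<le> 2 / real n"
    using ex_cesaro_mean[OF A n0] .
  have X1: "norm X \<le> 1" using X(1) by (simp add: unit_defects_def)
  have "(norm (lmul X h))\<^sup>2 \<le> 2 / real n"
    using norm_lmul_square_le[OF X1, of h] X(2) by (simp add: h(1) A1 mult_embed norm_embed)
  also have "\<dots> < \<delta>\<^sup>2" using n n0 \<delta> by (simp add: field_simps)
  finally have "norm (lmul X h) < \<delta>" using \<delta> by (rule power2_less_imp_less[OF _ less_imp_le])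
  then have "t * norm (lmul X (l * adj l)) < t * \<epsilon>\<^sup>2"
    using t by (simp add: h_def blinfun.scaleR_right \<delta>_def)
  then have "norm (lmul X (l * adj l)) < \<epsilon>\<^sup>2" using t by simp
  then have "(norm (lmul X l))\<^sup>2 < \<epsilon>\<^sup>2" using norm_lmul_square_le[OF X1, of l] by simp
  then have "norm (lmul X l) < \<epsilon>" using assms by (rule power2_less_imp_less[OF _ less_imp_le])
  with X(1) that show ?thesis by blast
qed

lemma ex_joint_unit:
  assumes "finite B" "\<And>b \<epsilon>. (b, \<epsilon>) \<in> B \<Longrightarrow> 0 < \<epsilon>"
  shows "\<exists>e. norm (1 - embed e) \<le> 1 \<and> (\<forall>(b, \<epsilon>)\<in>B. norm (e * b - b) < \<epsilon>)"
proof -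
  have "\<exists>X\<in>unit_defects. \<forall>(b, \<epsilon>)\<in>B. norm (lmul X b) < \<epsilon>"
    using assms
  proof (induction B rule: finite_induct)
    case empty
    then show ?case using one_in_unit_defects by auto
  next
    case (insert p B)
    then obtain X where X: "X \<in> unit_defects" "\<forall>(b, \<epsilon>)\<in>B. norm (lmul X b) < \<epsilon>" by auto
    obtain b \<epsilon> where p: "p = (b, \<epsilon>)" "0 < \<epsilon>" using insert.prems by (cases p) auto
    obtain Y where Y: "Y \<in> unit_defects" "norm (lmul Y (lmul X b)) < \<epsilon>"
      using ex_unit_defect[OF p(2)] .
    have "norm (lmul Y (lmul X b')) \<le> norm (lmul X b')" for b'
    proof (rule order_trans[OF norm_lmul])
      show "norm Y * norm (lmul X b') \<le> norm (lmul X b')"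
        using Y(1) by (intro mult_left_le_one_le) (simp_all add: unit_defects_def)
    qed
    then have "\<forall>(b, \<epsilon>)\<in>insert p B. norm (lmul (Y * X) b) < \<epsilon>"
      using X(2) Y(2) by (fastforce simp: p lmul_simps intro: le_less_trans)
    then show ?case using mult_in_unit_defects[OF Y(1) X(1)] by blast
  qed
  then obtain e where e: "norm (1 - embed e) \<le> 1" "\<forall>(b, \<epsilon>)\<in>B. norm (lmul (1 - embed e) b) < \<epsilon>"
    by (auto simp: unit_defects_def)
  have "norm (lmul (1 - embed e) b) = norm (e * b - b)" for b
    by (simp add: lmul_simps blinfun.diff_left lmul_one lmul_embed norm_minus_commute)
  with e show ?thesis by auto
qed

text \<open>The approximate unit is the filter of these elements rather than a net, so that limits
  along it are ordinary filter limits and no index set has to be chosen.\<close>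

definition approximate_unit :: "'a::cstar_algebra filter" where
  "approximate_unit = (INF (b, \<epsilon>)\<in>UNIV \<times> {0<..}.
     principal {e. norm (1 - embed e) \<le> 1 \<and> norm (e * b - b) < \<epsilon>})"

lemma approximate_unit_not_bot: "approximate_unit \<noteq> bot"
  unfolding approximate_unit_def
proof (rule INF_filter_not_bot)
  fix B :: "('a \<times> real) set"
  assume B: "B \<subseteq> UNIV \<times> {0<..}" "finite B"
  have "\<exists>e. norm (1 - embed e) \<le> 1 \<and> (\<forall>(b, \<epsilon>)\<in>B. norm (e * b - b) < \<epsilon>)"
    by (rule ex_joint_unit) (use B in auto)
  then have "(\<Inter>(b, \<epsilon>)\<in>B. {e. norm (1 - embed e) \<le> 1 \<and> norm (e * b - b) < \<epsilon>}) \<noteq> {}"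
    by auto
  then show "(INF (b, \<epsilon>)\<in>B. principal {e. norm (1 - embed e) \<le> 1 \<and> norm (e * b - b) < \<epsilon>}) \<noteq> bot"
    using INF_principal_finite[OF B(2), of "\<lambda>(b, \<epsilon>). {e. norm (1 - embed e) \<le> 1 \<and> norm (e * b - b) < \<epsilon>}"]
    by (simp add: case_prod_unfold principal_eq_bot_iff)
qed

lemma eventually_approximate_unit:
  assumes "0 < \<epsilon>"
  shows "\<forall>\<^sub>F e in approximate_unit. norm (1 - embed e) \<le> 1 \<and> norm (e * b - b) < \<epsilon>"
  unfolding approximate_unit_def
  by (rule eventually_INF1[of "(b, \<epsilon>)"]) (use assms in \<open>auto simp: eventually_principal\<close>)

lemma tendsto_approximate_unit: "((\<lambda>e. e * b) \<longlongrightarrow> b) approximate_unit"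
  unfolding tendsto_iff dist_norm
  by (blast intro: eventually_mono[OF eventually_approximate_unit])

lemma approximate_unit_contractive_complement: "\<forall>\<^sub>F e in approximate_unit. norm (1 - embed e) \<le> 1"
  using eventually_approximate_unit[of 1 0] by (auto elim: eventually_mono)

lemma norm_le_two_if_contractive_complement:
  assumes "norm (1 - embed e) \<le> 1" shows "norm e \<le> 2"
proof -
  have "norm (embed e) \<le> norm (1 :: 'a multiplier) + norm (1 - embed e)"
    using norm_triangle_ineq4[of 1 "1 - embed e"] by simp
  then show ?thesis using assms norm_one_multiplier[where 'a = 'a] by (simp add: norm_embed)
qed

section \<open>Nondegenerate Banach modules\<close>

lemma
  assumes "csubspace S"
  shows csubspace_zero: "0 \<in> S"
    and csubspace_add: "x \<in> S \<Longrightarrow> y \<in> S \<Longrightarrow> x + y \<in> S"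
    and csubspace_scaleC: "x \<in> S \<Longrightarrow> c *\<^sub>C x \<in> S"
    and csubspace_scaleR: "x \<in> S \<Longrightarrow> r *\<^sub>R x \<in> S"
    and csubspace_diff: "x \<in> S \<Longrightarrow> y \<in> S \<Longrightarrow> x - y \<in> S"
proof -
  show zero: "0 \<in> S" and add: "x \<in> S \<Longrightarrow> y \<in> S \<Longrightarrow> x + y \<in> S"
    and scaleC: "x \<in> S \<Longrightarrow> c *\<^sub>C x \<in> S" for x y c
    using assms by (auto simp: csubspace_def)
  show "x \<in> S \<Longrightarrow> r *\<^sub>R x \<in> S" by (simp add: scaleR_scaleC scaleC)
  have minus: "x \<in> S \<Longrightarrow> - x \<in> S" for x using scaleC[of x "- 1"] by (simp add: scaleC_minus_one)
  show "x \<in> S \<Longrightarrow> y \<in> S \<Longrightarrow> x - y \<in> S" using add[of x "- y"] minus[of y] by simp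
qed

lemma csubspace_hull: "csubspace (csubspace hull S)"
  by (rule hull_in) (auto simp: csubspace_def)

lemma csubspace_closure:
  fixes S :: "'a::complex_normed_vector set"
  assumes "csubspace S" shows "csubspace (closure S)"
  unfolding csubspace_def
proof (intro conjI ballI allI)
  show "0 \<in> closure S" using csubspace_zero[OF assms] closure_subset by blast
next
  fix x y assume "x \<in> closure S" "y \<in> closure S"
  then obtain f g where f: "\<forall>n. f n \<in> S" "f \<longlonglongrightarrow> x" and g: "\<forall>n. g n \<in> S" "g \<longlonglongrightarrow> y"
    by (auto simp only: closure_sequential)
  show "x + y \<in> closure S"
    unfolding closure_sequential
    by (rule exI[of _ "\<lambda>n. f n + g n"]) (simp add: f g csubspace_add[OF assms] tendsto_add)
next
  fix c x assume "x \<in> closure S"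
  then obtain f where f: "\<forall>n. f n \<in> S" "f \<longlonglongrightarrow> x"
    by (auto simp only: closure_sequential)
  show "c *\<^sub>C x \<in> closure S"
    unfolding closure_sequential
    by (rule exI[of _ "\<lambda>n. c *\<^sub>C f n"])
      (simp add: f csubspace_scaleC[OF assms] bounded_linear.tendsto[OF bounded_linear_scaleC])
qed

lemma closure_csubspace_hull_minimal:
  fixes S :: "'a::complex_normed_vector set"
  assumes "S \<subseteq> N" "csubspace N" "closed N" shows "closure (csubspace hull S) \<subseteq> N"
  by (intro closure_minimal hull_minimal assms)

lemma convergent_if_geometric_steps:
  fixes f :: "nat \<Rightarrow> 'a::banach"
  assumes "\<And>n. norm (f (Suc n) - f n) \<le> (1/2) ^ n"
  shows "convergent f"
proof -
  have "summable (\<lambda>n. f (Suc n) - f n)"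
    using assms by (intro summable_comparison_test'[OF summable_geometric[of "1/2 :: real"]]) auto
  then have "convergent (\<lambda>n. f n - f 0)"
    by (simp add: summable_iff_convergent sum_lessThan_telescope)
  from convergent_add[OF this convergent_const[of "f 0"]] show ?thesis by simp
qed

text \<open>The two instances needed are representations on a Hilbert space and, for a nondegenerate
  morphism \<open>\<phi>\<close> into the multiplier algebra of \<open>\<C>\<close>, the action of \<open>\<phi> b\<close> on \<open>\<C>\<close> from the left.\<close>

locale nondegenerate_module =
  fixes H :: "'v::{complex_normed_vector,banach} set" and T :: "'b::cstar_algebra \<Rightarrow> 'v \<Rightarrow> 'v"
  assumes closed_space: "closed H" and csubspace_space: "csubspace H"
    and act_in: "x \<in> H \<Longrightarrow> T b x \<in> H"
    and act_add_left: "x \<in> H \<Longrightarrow> T (a + b) x = T a x + T b x"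
    and act_scaleC_left: "x \<in> H \<Longrightarrow> T (c *\<^sub>C a) x = c *\<^sub>C T a x"
    and act_add_right: "x \<in> H \<Longrightarrow> y \<in> H \<Longrightarrow> T a (x + y) = T a x + T a y"
    and act_scaleC_right: "x \<in> H \<Longrightarrow> T a (c *\<^sub>C x) = c *\<^sub>C T a x"
    and act_mult: "x \<in> H \<Longrightarrow> T (a * b) x = T a (T b x)"
    and norm_act: "x \<in> H \<Longrightarrow> norm (T a x) \<le> norm a * norm x"
    and nondegenerate: "H \<subseteq> closure (csubspace hull {T b x | b x. x \<in> H})"
begin

lemmas space_zero = csubspace_zero[OF csubspace_space]
  and space_add = csubspace_add[OF csubspace_space]
  and space_diff = csubspace_diff[OF csubspace_space]
  and space_scaleC = csubspace_scaleC[OF csubspace_space]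
  and space_scaleR = csubspace_scaleR[OF csubspace_space]

lemma bounded_linear_act: "x \<in> H \<Longrightarrow> bounded_linear (\<lambda>a. T a x)"
  by (rule bounded_linear_intro[where K = "norm x"])
    (simp_all add: act_add_left act_scaleC_left scaleR_scaleC norm_act)

lemma act_diff_left: "x \<in> H \<Longrightarrow> T (a - b) x = T a x - T b x"
  by (rule linear_diff[OF bounded_linear.linear[OF bounded_linear_act]])

lemma act_zero_left: "x \<in> H \<Longrightarrow> T 0 x = 0"
  by (rule linear_0[OF bounded_linear.linear[OF bounded_linear_act]])

lemma act_scaleR_left: "x \<in> H \<Longrightarrow> T (r *\<^sub>R a) x = r *\<^sub>R T a x"
  by (simp add: act_scaleC_left scaleR_scaleC)

lemma act_scaleR_right: "x \<in> H \<Longrightarrow> T a (r *\<^sub>R x) = r *\<^sub>R T a x"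
  by (simp add: act_scaleC_right scaleR_scaleC)

lemma act_diff_right: "x \<in> H \<Longrightarrow> y \<in> H \<Longrightarrow> T a (x - y) = T a x - T a y"
  using act_add_right[of "x - y" y a] by (simp add: space_diff)

lemma tendsto_act:
  assumes a: "(f \<longlongrightarrow> a) F" and x: "(g \<longlongrightarrow> x) F" and H: "\<And>i. g i \<in> H" "x \<in> H"
  shows "((\<lambda>i. T (f i) (g i)) \<longlongrightarrow> T a x) F"
proof -
  have "((\<lambda>i. T (f i) x) \<longlongrightarrow> T a x) F"
    by (rule bounded_linear.tendsto[OF bounded_linear_act[OF H(2)] a])
  moreover have "((\<lambda>i. T (f i) (g i - x)) \<longlongrightarrow> 0) F"
  proof (rule Lim_null_comparison)
    show "\<forall>\<^sub>F i in F. norm (T (f i) (g i - x)) \<le> norm (f i) * norm (g i - x)"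
      by (simp add: norm_act space_diff H)
    have "((\<lambda>i. norm (f i) * norm (g i - x)) \<longlongrightarrow> norm a * norm (x - x)) F"
      by (intro tendsto_intros a x)
    then show "((\<lambda>i. norm (f i) * norm (g i - x)) \<longlongrightarrow> 0) F" by simp
  qed
  ultimately have "((\<lambda>i. T (f i) x + T (f i) (g i - x)) \<longlongrightarrow> T a x + 0) F" by (rule tendsto_add)
  then show ?thesis by (simp add: act_diff_right H)
qed

text \<open>The convergence is clear on the total set of vectors \<open>T b z\<close>, and it extends to the closed span
  because the approximate unit is bounded by two.\<close>

lemma tendsto_unit_act:
  assumes x: "x \<in> H"
  shows "((\<lambda>e. T e x) \<longlongrightarrow> x) approximate_unit"
proof -
  define K where "K = {x \<in> H. ((\<lambda>e. T e x) \<longlongrightarrow> x) approximate_unit}"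
  have "csubspace K"
    unfolding csubspace_def
  proof (intro conjI ballI allI)
    show "0 \<in> K" using space_zero act_scaleR_right[OF space_zero, of _ 0] by (simp add: K_def)
    show "x + y \<in> K" if "x \<in> K" "y \<in> K" for x y
      using that by (auto simp: K_def space_add act_add_right intro: tendsto_add)
    show "c *\<^sub>C x \<in> K" if "x \<in> K" for c x
      using that by (auto simp: K_def space_scaleC act_scaleC_right
          intro: bounded_linear.tendsto[OF bounded_linear_scaleC])
  qed
  moreover have "{T b z | b z. z \<in> H} \<subseteq> K"
  proof clarify
    fix b z assume z: "z \<in> H"
    have "((\<lambda>e. T (e * b) z) \<longlongrightarrow> T b z) approximate_unit"
      by (rule bounded_linear.tendsto[OF bounded_linear_act[OF z] tendsto_approximate_unit])
    then show "T b z \<in> K" by (simp add: K_def act_in z act_mult)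
  qed
  ultimately have "csubspace hull {T b z | b z. z \<in> H} \<subseteq> K" by (intro hull_minimal)
  then have xK: "x \<in> closure K" using nondegenerate x closure_mono by blast
  show ?thesis
    unfolding tendsto_iff
  proof (intro allI impI)
    fix \<epsilon> :: real assume \<epsilon>: "0 < \<epsilon>"
    obtain y where y: "y \<in> K" "dist y x < \<epsilon> / 6"
      using xK \<epsilon> unfolding closure_approachable by (metis zero_less_divide_iff zero_less_numeral)
    have yH: "y \<in> H" using y(1) by (simp add: K_def)
    have "\<forall>\<^sub>F e in approximate_unit. dist (T e y) y < \<epsilon> / 3"
      using y(1) \<epsilon> by (auto simp: K_def dest: tendstoD[where e = "\<epsilon> / 3"])
    then show "\<forall>\<^sub>F e in approximate_unit. dist (T e x) x < \<epsilon>"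
      using approximate_unit_contractive_complement
    proof eventually_elim
      case (elim e)
      have "norm (T e (x - y)) \<le> 2 * norm (x - y)"
        by (rule order_trans[OF norm_act]) (auto simp: space_diff x yH
            intro!: mult_right_mono norm_le_two_if_contractive_complement elim)
      then have "norm (T e x - T e y) \<le> 2 * norm (x - y)" by (simp add: act_diff_right x yH)
      moreover have "T e x - x = (T e x - T e y) + (T e y - y) + (y - x)" by simp
      ultimately have "norm (T e x - x) \<le> 2 * norm (x - y) + norm (T e y - y) + norm (y - x)"
        by (smt (verit) norm_triangle_ineq)
      then show ?case using elim(1) y(2) \<epsilon> by (simp add: dist_norm norm_minus_commute)
    qed
  qed
qed

text \<open>The operator to be inverted is \<open>1 - (s - p)\<close>. As \<open>\<parallel>s - p\<parallel> \<le> s < 1\<close>, it is invertible in the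
  unitization, and its inverse is \<open>(1 - k) / (1 - s)\<close> with \<open>k\<close> in the algebra itself, the fixed point
  of \<open>k \<mapsto> p + (s - p) k\<close>. Working with \<open>k\<close> avoids extending the action to the unitization, where
  its contractivity is not at hand. The constant in the bound is crude; it
  matters only that it depends on \<open>s\<close> alone.\<close>

lemma ex_solution:
  fixes p :: 'b
  assumes s: "0 \<le> s" "s < 1" and p: "norm (s *\<^sub>R 1 - embed p) \<le> s" and x: "x \<in> H"
  obtains d where "d \<in> H" "T p d + (1 - s) *\<^sub>R d = x" "norm d \<le> 3 / (1 - s)\<^sup>2 * norm x"
proof -
  let ?D = "s *\<^sub>R 1 - embed p"
  have D: "lmul ?D k = s *\<^sub>R k - p * k" for k
    by (simp add: lmul_simps blinfun.diff_left blinfun.scaleR_left lmul_one lmul_embed)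
  have D_le: "norm (lmul ?D k) \<le> s * norm k" for k
    using norm_lmul[of ?D k] mult_right_mono[OF p norm_ge_zero[of k]] by linarith
  have "\<exists>!k. k \<in> UNIV \<and> p + lmul ?D k = k"
    by (rule Banach_fix[OF complete_UNIV _ s])
      (auto simp: dist_norm D_le simp flip: blinfun.diff_right)
  then obtain k where k: "p + lmul ?D k = k" by blast
  have "norm p = norm (s *\<^sub>R (1 :: 'b multiplier) - ?D)" by (simp add: norm_embed)
  also have "\<dots> \<le> norm (s *\<^sub>R (1 :: 'b multiplier)) + norm ?D" by (rule norm_triangle_ineq4)
  also have "\<dots> \<le> s * 1 + s"
    using s(1) p norm_one_multiplier[where 'a = 'b] by (intro add_mono) (auto intro: mult_left_le)
  finally have "norm p \<le> 2" using s by simp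
  moreover have "norm k \<le> norm p + s * norm k"
    using norm_triangle_ineq[of p "lmul ?D k"] D_le[of k] by (simp add: k)
  ultimately have "norm k * (1 - s) \<le> 2" by (simp add: algebra_simps)
  then have k_le: "norm k \<le> 2 / (1 - s)" using s(2) by (simp add: field_simps)
  have pk: "p - p * k = (1 - s) *\<^sub>R k"
    using k unfolding D by (simp add: algebra_simps)
  define d where "d = (1 / (1 - s)) *\<^sub>R (x - T k x)"
  have dH: "d \<in> H" by (simp add: d_def space_scaleR space_diff act_in x)
  have "T p d = (1 / (1 - s)) *\<^sub>R T (p - p * k) x"
    by (simp add: d_def act_scaleR_right space_diff act_in x act_diff_right act_diff_left act_mult)
  also have "\<dots> = T k x" using s(2) by (simp add: pk act_scaleR_left x)
  finally have "T p d + (1 - s) *\<^sub>R d = x" using s(2) by (simp add: d_def)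
  moreover have "norm d \<le> 3 / (1 - s)\<^sup>2 * norm x"
  proof -
    have "1 \<le> 1 / (1 - s)" using s by (simp add: field_simps)
    then have "1 + norm k \<le> 3 / (1 - s)"
      using k_le by (simp add: field_simps)
    then have "norm x + norm k * norm x \<le> 3 / (1 - s) * norm x"
      using mult_right_mono[OF _ norm_ge_zero[of x], of "1 + norm k" "3 / (1 - s)"]
      by (simp add: algebra_simps)
    then have "norm (x - T k x) \<le> 3 / (1 - s) * norm x"
      using norm_triangle_ineq4[of x "T k x"] norm_act[OF x, of k] by linarith
    then have "norm (x - T k x) / (1 - s) \<le> 3 / (1 - s) * norm x / (1 - s)"
      using s(2) by (intro divide_right_mono) auto
    then show ?thesis using s(2) by (simp add: d_def power2_eq_square)
  qed
  ultimately show ?thesis using that dH by blast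
qed

text \<open>This is Cohen's factorization theorem. The factor is \<open>l = \<Sum>n. e\<^sub>n / 2\<^sup>n\<close>, and \<open>y\<close> is the limit of
  the solutions \<open>y\<^sub>n\<close> of \<open>p\<^sub>n y\<^sub>n + y\<^sub>n / 2\<^sup>n = x\<close> for the partial sums \<open>p\<^sub>n\<close>. Since \<open>\<parallel>1 - e\<^sub>n\<parallel> \<le> 1\<close>, the sums
  satisfy \<open>\<parallel>s - p\<^sub>n\<parallel> \<le> s\<close> with \<open>s = 1 - 1 / 2\<^sup>n\<close>, which makes these equations solvable with a bound
  depending only on \<open>n\<close>; so if \<open>e\<^bsub>n+1\<^esub>\<close> is close enough to a unit for \<open>y\<^sub>n\<close>, then
  \<open>y\<^bsub>n+1\<^esub>\<close> is as close to \<open>y\<^sub>n\<close> as desired.\<close>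

theorem cohen_factorization:
  assumes x: "x \<in> H"
  obtains l y where "y \<in> H" "x = T l y"
proof -
  define P where "P n = (\<lambda>(p, y). norm ((1 - (1/2) ^ n) *\<^sub>R 1 - embed p) \<le> 1 - (1/2) ^ n \<and>
    y \<in> H \<and> T p y + (1/2) ^ n *\<^sub>R y = x)" for n :: nat
  define Q where "Q n = (\<lambda>(p :: 'b, y) (p', y'). norm (p' - p) \<le> (1/2) ^ n \<and>
    norm (y' - y :: 'v) \<le> (1/2) ^ n)" for n :: nat
  have "\<exists>g. \<forall>n. P n (g n) \<and> Q n (g n) (g (Suc n))"
  proof (rule dependent_nat_choice)
    show "\<exists>g. P 0 g"
      by (rule exI[of _ "(0, x)"])
        (simp add: P_def x act_zero_left star_hom_zero[OF star_hom_embed])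
  next
    fix g n assume "P n g"
    then obtain p y where g: "g = (p, y)" and y: "y \<in> H"
      and p: "norm ((1 - (1/2) ^ n) *\<^sub>R 1 - embed p) \<le> 1 - (1/2) ^ n"
      and eq: "T p y + (1/2) ^ n *\<^sub>R y = x"
      by (auto simp: P_def split: prod.splits)
    \<comment> \<open>\<open>q = 1 - s\<close> for the next partial sum; \<open>\<delta>\<close> compensates the bound of the solution operator\<close>
    define q where "q = ((1/2) ^ Suc n :: real)"
    have q: "0 < q" "q \<le> 1" "(1/2) ^ n = q + q" unfolding q_def
      using power_le_one[of "1/2 :: real" "Suc n"] by simp_all
    define \<delta> where "\<delta> = (q + q) / (3 / q\<^sup>2)"
    have \<delta>: "0 < \<delta>" using q by (simp add: \<delta>_def)
    have "\<forall>\<^sub>F e in approximate_unit. norm (1 - embed e) \<le> 1 \<and> dist (T e y) y < \<delta>"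
      by (intro eventually_conj approximate_unit_contractive_complement
          tendstoD[OF tendsto_unit_act[OF y] \<delta>])
    then obtain e where e: "norm (1 - embed e) \<le> 1" "dist (T e y) y < \<delta>"
      using eventually_happens'[OF approximate_unit_not_bot] by blast
    define p' where "p' = p + q *\<^sub>R e"
    have p': "norm ((1 - q) *\<^sub>R 1 - embed p') \<le> 1 - q"
    proof -
      have "(1 - q) *\<^sub>R 1 - embed p' = ((1 - (1/2) ^ n) *\<^sub>R 1 - embed p) + q *\<^sub>R (1 - embed e)"
        using scaleR_add_left[of q q "1 :: 'b multiplier"]
        by (simp add: p'_def q(3) star_hom_add[OF star_hom_embed] star_hom_scaleR[OF star_hom_embed]
            scaleR_diff_left scaleR_diff_right)
      then have "norm ((1 - q) *\<^sub>R 1 - embed p') \<le>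
          norm ((1 - (1/2) ^ n) *\<^sub>R 1 - embed p) + norm (q *\<^sub>R (1 - embed e))"
        by (metis norm_triangle_ineq)
      also have "\<dots> \<le> (1 - (q + q)) + q * 1"
        using p e(1) q by (intro add_mono) (auto intro: mult_left_mono)
      finally show ?thesis by simp
    qed
    obtain d where d: "d \<in> H" "T p' d + (1 - (1 - q)) *\<^sub>R d = q *\<^sub>R (y - T e y)"
      "norm d \<le> 3 / (1 - (1 - q))\<^sup>2 * norm (q *\<^sub>R (y - T e y))"
      by (rule ex_solution[OF _ _ p', of "q *\<^sub>R (y - T e y)"])
        (use q in \<open>simp_all add: space_scaleR space_diff act_in y\<close>)
    have "T p' (y + d) + q *\<^sub>R (y + d) = T p' y + q *\<^sub>R y + (T p' d + q *\<^sub>R d)"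
      by (simp add: act_add_right y d(1) scaleR_add_right)
    also have "\<dots> = T p y + (1/2) ^ n *\<^sub>R y"
      using d(2) scaleR_add_left[of q q y]
      by (simp add: p'_def q(3) act_add_left act_scaleR_left y algebra_simps)
    finally have "T p' (y + d) + q *\<^sub>R (y + d) = x" by (simp add: eq)
    then have "P (Suc n) (p', y + d)"
      using p' y d(1) by (simp add: P_def space_add q_def[symmetric] del: power_Suc)
    moreover have "norm (p' - p) \<le> (1/2) ^ n"
      using q mult_left_mono[OF norm_le_two_if_contractive_complement[OF e(1)], of q]
      by (simp add: p'_def q(3))
    moreover have "norm d \<le> (1/2) ^ n"
    proof -
      have "norm d \<le> 3 / q\<^sup>2 * (q * norm (y - T e y))" using d(3) q by simp
      also have "\<dots> \<le> 3 / q\<^sup>2 * (1 * \<delta>)"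
        using q e(2) \<delta> by (intro mult_left_mono mult_mono) (auto simp: dist_norm norm_minus_commute)
      also have "\<dots> = (1/2) ^ n" using q by (simp add: \<delta>_def)
      finally show ?thesis .
    qed
    ultimately show "\<exists>g'. P (Suc n) g' \<and> Q n g g'"
      by (intro exI[of _ "(p', y + d)"]) (simp add: Q_def g)
  qed
  then obtain g where g: "\<And>n. P n (g n)" "\<And>n. Q n (g n) (g (Suc n))" by blast
  have "convergent (\<lambda>n. fst (g n))" "convergent (\<lambda>n. snd (g n))"
    using g(2) by (auto intro!: convergent_if_geometric_steps simp: Q_def case_prod_unfold)
  then obtain l y where l: "(\<lambda>n. fst (g n)) \<longlonglongrightarrow> l" and y: "(\<lambda>n. snd (g n)) \<longlonglongrightarrow> y"
    by (auto simp: convergent_def)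
  have gH: "snd (g n) \<in> H" and eq: "T (fst (g n)) (snd (g n)) + (1/2) ^ n *\<^sub>R snd (g n) = x" for n
    using g(1)[of n] by (auto simp: P_def case_prod_unfold)
  have yH: "y \<in> H" using closed_sequentially[OF closed_space _ y] gH by blast
  have "(\<lambda>n. T (fst (g n)) (snd (g n)) + (1/2) ^ n *\<^sub>R snd (g n)) \<longlonglongrightarrow> T l y + 0 *\<^sub>R y"
    by (intro tendsto_add tendsto_act tendsto_scaleR l y gH yH LIMSEQ_realpow_zero) auto
  then have "(\<lambda>n. x) \<longlonglongrightarrow> T l y" by (simp add: eq)
  then have "x = T l y" by (rule LIMSEQ_unique[OF tendsto_const])
  with yH that show ?thesis by blast
qed

text \<open>The action of multipliers. On a factored vector \<open>T l y\<close> it is \<open>T (M l) y\<close>, but factorizations are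
  neither unique nor linear; the limit along the approximate unit shows that the result
  depends linearly on the vector alone.\<close>

definition extended_act :: "'b multiplier \<Rightarrow> 'v \<Rightarrow> 'v" where
  "extended_act M x = Lim approximate_unit (\<lambda>e. T (lmul M e) x)"

lemma
  assumes y: "y \<in> H"
  shows extended_act_act: "extended_act M (T l y) = T (lmul M l) y"
    and tendsto_extended_act_act:
      "((\<lambda>e. T (lmul M e) (T l y)) \<longlongrightarrow> T (lmul M l) y) approximate_unit"
proof -
  have "((\<lambda>e. T (lmul M (e * l)) y) \<longlongrightarrow> T (lmul M l) y) approximate_unit"
    by (intro bounded_linear.tendsto[OF bounded_linear_act[OF y]]
        blinfun.tendsto tendsto_const tendsto_approximate_unit)
  then show lim: "((\<lambda>e. T (lmul M e) (T l y)) \<longlongrightarrow> T (lmul M l) y) approximate_unit"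
    by (simp add: lmul_mult act_mult y)
  then show "extended_act M (T l y) = T (lmul M l) y"
    unfolding extended_act_def by (rule tendsto_Lim[OF approximate_unit_not_bot])
qed

lemma tendsto_extended_act:
  assumes "x \<in> H" shows "((\<lambda>e. T (lmul M e) x) \<longlongrightarrow> extended_act M x) approximate_unit"
  using assms by (rule cohen_factorization) (simp add: extended_act_act tendsto_extended_act_act)

lemmas extended_act_eqI = tendsto_unique[OF approximate_unit_not_bot tendsto_extended_act]

lemma extended_act_in: "x \<in> H \<Longrightarrow> extended_act M x \<in> H"
  by (rule cohen_factorization[of x]) (simp_all add: extended_act_act act_in)

lemma extended_act_add_right:
  assumes "x \<in> H" "y \<in> H"
  shows "extended_act M (x + y) = extended_act M x + extended_act M y"
  using tendsto_add[OF tendsto_extended_act[OF assms(1), of M] tendsto_extended_act[OF assms(2), of M]]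
  by (intro extended_act_eqI) (simp_all add: assms space_add act_add_right)

lemma extended_act_scaleC_right:
  assumes "x \<in> H"
  shows "extended_act M (c *\<^sub>C x) = c *\<^sub>C extended_act M x"
  using bounded_linear.tendsto[OF bounded_linear_scaleC tendsto_extended_act[OF assms, of M]]
  by (intro extended_act_eqI) (simp_all add: assms space_scaleC act_scaleC_right)

lemma norm_extended_act:
  assumes x: "x \<in> H"
  shows "norm (extended_act M x) \<le> 2 * norm M * norm x"
proof (rule tendsto_upperbound[OF tendsto_norm[OF tendsto_extended_act[OF x]] _ approximate_unit_not_bot])
  show "\<forall>\<^sub>F e in approximate_unit. norm (T (lmul M e) x) \<le> 2 * norm M * norm x"
    using approximate_unit_contractive_complement
  proof eventually_elim
    case (elim e)
    have "norm (lmul M e) \<le> norm M * 2"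
      by (rule order_trans[OF norm_lmul])
        (intro mult_left_mono norm_le_two_if_contractive_complement elim norm_ge_zero)
    then show ?case
      using order_trans[OF norm_act[OF x] mult_right_mono[OF _ norm_ge_zero[of x]]] by (metis mult.commute)
  qed
qed

lemma
  assumes x: "x \<in> H"
  shows extended_act_add_left: "extended_act (M + N) x = extended_act M x + extended_act N x"
    and extended_act_scaleC_left: "extended_act (c *\<^sub>C M) x = c *\<^sub>C extended_act M x"
    and extended_act_mult: "extended_act (M * N) x = extended_act M (extended_act N x)"
    and extended_act_one: "extended_act 1 x = x"
    and extended_act_embed: "extended_act (embed b) x = T b x"
proof -
  obtain l y where y: "y \<in> H" "x = T l y" using x by (rule cohen_factorization)
  note simps = y extended_act_act lmul_simps blinfun.add_left act_add_left act_scaleC_left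
    lmul_one lmul_embed act_mult
  show "extended_act (M + N) x = extended_act M x + extended_act N x"
    "extended_act (c *\<^sub>C M) x = c *\<^sub>C extended_act M x"
    "extended_act (M * N) x = extended_act M (extended_act N x)"
    "extended_act 1 x = x" "extended_act (embed b) x = T b x"
    by (simp_all add: simps)
qed

end

section \<open>Extension of nondegenerate morphisms to the multiplier algebra\<close>

lemma ex_multiplier:
  fixes l r :: "'a::cstar_algebra \<Rightarrow> 'a"
  assumes "bounded_linear l" "bounded_linear r"
    and "\<And>c x. l (c *\<^sub>C x) = c *\<^sub>C l x" "\<And>c x. r (c *\<^sub>C x) = c *\<^sub>C r x"
    and "\<And>x y. x * l y = r x * y"
  obtains M where "\<And>x. lmul M x = l x" "\<And>x. rmul M x = r x"
proof -
  have "(Blinfun l, Blinfun r) \<in> {(l :: 'a \<Rightarrow>\<^sub>L 'a, r :: 'a \<Rightarrow>\<^sub>L 'a).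
      (\<forall>c x. l (c *\<^sub>C x) = c *\<^sub>C l x) \<and> (\<forall>c x. r (c *\<^sub>C x) = c *\<^sub>C r x) \<and>
      (\<forall>x y. x * l y = r x * y)}"
    using assms by (simp add: bounded_linear_Blinfun_apply)
  then show ?thesis
    using that[of "Abs_multiplier (Blinfun l, Blinfun r)"] assms(1,2)
    by (simp add: lmul.rep_eq rmul.rep_eq Abs_multiplier_inverse bounded_linear_Blinfun_apply)
qed

locale nondegenerate_morphism =
  fixes \<phi> :: "'s::cstar_algebra \<Rightarrow> 'b::cstar_algebra multiplier"
  assumes star_hom: "star_hom \<phi>" and nondegenerate_hom: "nondegenerate_hom \<phi>"
begin

sublocale nondegenerate_module UNIV "\<lambda>s. blinfun_apply (lmul (\<phi> s))"
proof
  show "norm (lmul (\<phi> a) x) \<le> norm a * norm x" for a x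
    using norm_lmul[of "\<phi> a" x] mult_right_mono[OF norm_star_hom_le[OF star_hom] norm_ge_zero]
    by (rule order_trans)
  show "UNIV \<subseteq> closure (csubspace hull {lmul (\<phi> b) x | b x. x \<in> UNIV})"
    using nondegenerate_hom by (simp add: nondegenerate_hom_def)
qed (simp_all add: csubspace_def star_hom_add[OF star_hom] star_hom_scaleC[OF star_hom]
    star_hom_mult[OF star_hom] lmul_simps lmul_scaleC blinfun.add_left blinfun.add_right)

lemma left_factorization:
  obtains s d where "c = lmul (\<phi> s) d"
  using cohen_factorization[of c] by blast

lemma hom_act_adj: "adj (lmul (\<phi> s) c) * lmul (\<phi> t) d = adj c * lmul (\<phi> (adj s * t)) d"
proof -
  have "adj (lmul (\<phi> s) c) = rmul (\<phi> (adj s)) (adj c)"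
    by (simp add: star_hom_adj[OF star_hom] mul_adj adj_adj)
  then show ?thesis
    by (simp add: star_hom_mult[OF star_hom] lmul_simps mult_lmul[symmetric])
qed

lemma bounded_linear_extended_act: "bounded_linear (extended_act M)"
  by (rule bounded_linear_intro[where K = "2 * norm M"])
    (use norm_extended_act[of _ M] in
      \<open>simp_all add: extended_act_add_right extended_act_scaleC_right scaleR_scaleC mult.commute\<close>)

text \<open>The right action of a multiplier is the adjoint of the left action of its adjoint.\<close>

lemma extended_act_centralizer:
  "x * extended_act M y = adj (extended_act (adj M) (adj x)) * y"
proof -
  obtain s d where y: "y = lmul (\<phi> s) d" by (rule left_factorization)
  obtain t c where x: "adj x = lmul (\<phi> t) c" by (rule left_factorization)
  have "x * extended_act M y = adj (lmul (\<phi> t) c) * lmul (\<phi> (lmul M s)) d"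
    by (simp add: y extended_act_act adj_adj flip: x)
  also have "\<dots> = adj (lmul (\<phi> (lmul (adj M) t)) c) * lmul (\<phi> s) d"
    unfolding hom_act_adj by (simp only: mul_adj adj_adj mult_lmul)
  finally show ?thesis by (simp add: x y extended_act_act)
qed

lemma ex_extension:
  obtains \<Phi> where "star_hom \<Phi>" "\<Phi> 1 = 1" "\<And>s. \<Phi> (embed s) = \<phi> s"
    "\<And>M s c. lmul (\<Phi> M) (lmul (\<phi> s) c) = lmul (\<phi> (lmul M s)) c"
    "\<And>M s c. rmul (\<Phi> M) (adj (lmul (\<phi> s) c)) = adj (lmul (\<phi> (lmul (adj M) s)) c)"
proof -
  have "\<exists>N. \<forall>x. lmul N x = extended_act M x \<and> rmul N x = adj (extended_act (adj M) (adj x))" for M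
  proof -
    have r: "bounded_linear (\<lambda>x. adj (extended_act (adj M) (adj x)))"
      by (intro bounded_linear_compose[OF bounded_linear_adj]
          bounded_linear_compose[OF bounded_linear_extended_act] bounded_linear_adj)
    show ?thesis
      by (rule ex_multiplier[OF bounded_linear_extended_act r])
        (auto simp: extended_act_scaleC_right adj_scaleC extended_act_centralizer)
  qed
  then obtain \<Phi> where l: "\<And>M x. lmul (\<Phi> M) x = extended_act M x"
    and r: "\<And>M x. rmul (\<Phi> M) x = adj (extended_act (adj M) (adj x))"
    by metis
  have "star_hom \<Phi>"
    unfolding star_hom_def
    by (auto intro!: multiplier_eqI simp: l r lmul_simps blinfun.add_left mul_adj adj_adj
        extended_act_add_left extended_act_scaleC_left extended_act_mult)
  moreover have "\<Phi> 1 = 1" "\<Phi> (embed s) = \<phi> s" for s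
    by (auto intro!: multiplier_eqI simp: l lmul_one extended_act_one extended_act_embed)
  moreover have "lmul (\<Phi> M) (lmul (\<phi> s) c) = lmul (\<phi> (lmul M s)) c"
    "rmul (\<Phi> M) (adj (lmul (\<phi> s) c)) = adj (lmul (\<phi> (lmul (adj M) s)) c)" for M s c
    by (simp_all add: l r adj_adj extended_act_act)
  ultimately show ?thesis using that by blast
qed

text \<open>Every element \<open>c\<close> factors exactly as \<open>\<phi> s d\<close>, and so does its adjoint. Hence \<open>\<parallel>\<Phi> M c\<parallel>\<close> is bounded by
  \<open>\<parallel>M s\<parallel> \<parallel>d\<parallel>\<close>, and similarly on the other side: the seminorms of \<open>\<Phi> M\<close> are dominated by seminorms of
  \<open>M\<close>. Approximating \<open>c\<close> by elements of the span would give continuity on bounded sets only.\<close>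

lemma strictly_continuous:
  assumes \<Phi>: "star_hom \<Phi>"
    and l: "\<And>M s c. lmul (\<Phi> M) (lmul (\<phi> s) c) = lmul (\<phi> (lmul M s)) c"
    and r: "\<And>M s c. rmul (\<Phi> M) (adj (lmul (\<phi> s) c)) = adj (lmul (\<phi> (lmul (adj M) s)) c)"
  shows "continuous_map strict_topology strict_topology \<Phi>"
proof -
  define nbhd :: "'s multiplier \<Rightarrow> 's \<Rightarrow> real \<Rightarrow> 's multiplier set" where
    "nbhd M b e = {N. norm (lmul (N - M) b) + norm (rmul (N - M) b) < e}" for M b e
  have open_nbhd: "openin strict_topology (nbhd M b e)" if "0 < e" for M b e
    unfolding strict_topology_def nbhd_def using that by (intro topology_generated_by_Basis) blast
  show ?thesis
    unfolding strict_topology_def[where 'a = 'b]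
  proof (rule continuous_on_generated_topo)
    fix U :: "'b multiplier set"
    assume "U \<in> {{N. norm (lmul (N - M) b) + norm (rmul (N - M) b) < e} | M b e. 0 < e}"
    then obtain K c e where U: "U = {N. norm (lmul (N - K) c) + norm (rmul (N - K) c) < e}"
      by blast
    obtain s d where c: "c = lmul (\<phi> s) d" by (rule left_factorization)
    obtain t f where adjc: "adj c = lmul (\<phi> t) f" by (rule left_factorization)
    have le: "norm (lmul (\<Phi> M) c) + norm (rmul (\<Phi> M) c) \<le>
        norm (lmul M s) * norm d + norm (rmul M (adj t)) * norm f" for M
    proof -
      have "norm (lmul (\<Phi> M) c) \<le> norm (lmul M s) * norm d"
        by (simp add: c l norm_act)
      moreover have "c = adj (lmul (\<phi> t) f)" by (simp flip: adjc add: adj_adj)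
      then have "rmul (\<Phi> M) c = adj (lmul (\<phi> (lmul (adj M) t)) f)" by (simp add: r)
      then have "norm (rmul (\<Phi> M) c) \<le> norm (rmul M (adj t)) * norm f"
        using norm_act[of f "lmul (adj M) t"] by (simp add: norm_adj mul_adj)
      ultimately show ?thesis by linarith
    qed
    show "openin strict_topology (\<Phi> -` U \<inter> topspace strict_topology)"
    proof (subst openin_subopen, intro ballI)
      fix M assume "M \<in> \<Phi> -` U \<inter> topspace strict_topology"
      then have M: "norm (lmul (\<Phi> M - K) c) + norm (rmul (\<Phi> M - K) c) < e" by (simp add: U)
      define \<delta> where "\<delta> = e - (norm (lmul (\<Phi> M - K) c) + norm (rmul (\<Phi> M - K) c))"
      have \<delta>: "0 < \<delta>" using M by (simp add: \<delta>_def)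
      define \<gamma> where "\<gamma> = \<delta> / (2 * (norm d + norm f + 1))"
      have pos: "0 < norm d + norm f + 1" by (simp add: add_nonneg_pos)
      then have \<gamma>: "0 < \<gamma>" using \<delta> by (simp add: \<gamma>_def)
      have "nbhd M s \<gamma> \<inter> nbhd M (adj t) \<gamma> \<subseteq> \<Phi> -` U"
      proof
        fix N assume "N \<in> nbhd M s \<gamma> \<inter> nbhd M (adj t) \<gamma>"
        then have N: "norm (lmul (N - M) s) \<le> \<gamma>" "norm (rmul (N - M) (adj t)) \<le> \<gamma>"
          using norm_ge_zero[of "rmul (N - M) s"] norm_ge_zero[of "lmul (N - M) (adj t)"]
          by (simp_all add: nbhd_def del: norm_ge_zero)
        have "norm (lmul (\<Phi> (N - M)) c) + norm (rmul (\<Phi> (N - M)) c) \<le> \<gamma> * norm d + \<gamma> * norm f"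
          using le[of "N - M"] mult_right_mono[OF N(1) norm_ge_zero[of d]]
            mult_right_mono[OF N(2) norm_ge_zero[of f]] by linarith
        also have "\<dots> < \<gamma> * (2 * (norm d + norm f + 1))"
          using \<gamma> by (simp add: algebra_simps add_nonneg_pos add_pos_nonneg)
        also have "\<dots> = \<delta>" using pos by (simp add: \<gamma>_def)
        finally have "norm (lmul (\<Phi> N - \<Phi> M) c) + norm (rmul (\<Phi> N - \<Phi> M) c) < \<delta>"
          by (simp add: star_hom_diff[OF \<Phi>])
        moreover have "norm (lmul (\<Phi> N - K) c) \<le> norm (lmul (\<Phi> N - \<Phi> M) c) + norm (lmul (\<Phi> M - K) c)"
          "norm (rmul (\<Phi> N - K) c) \<le> norm (rmul (\<Phi> N - \<Phi> M) c) + norm (rmul (\<Phi> M - K) c)"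
          using norm_triangle_ineq[of "lmul (\<Phi> N - \<Phi> M) c" "lmul (\<Phi> M - K) c"]
            norm_triangle_ineq[of "rmul (\<Phi> N - \<Phi> M) c" "rmul (\<Phi> M - K) c"]
          by (simp_all add: lmul_simps rmul_simps blinfun.diff_left)
        ultimately show "N \<in> \<Phi> -` U" by (simp add: U \<delta>_def)
      qed
      moreover have "M \<in> nbhd M s \<gamma> \<inter> nbhd M (adj t) \<gamma>"
        using \<gamma> by (simp add: nbhd_def lmul_simps rmul_simps)
      moreover have "openin strict_topology (nbhd M s \<gamma> \<inter> nbhd M (adj t) \<gamma>)"
        by (intro openin_Int open_nbhd \<gamma>)
      ultimately show "\<exists>V. openin strict_topology V \<and> M \<in> V \<and> V \<subseteq> \<Phi> -` U \<inter> topspace strict_topology"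
        using openin_subset by blast
    qed
  next
    have "K \<in> {N. norm (lmul (N - K) 0) + norm (rmul (N - K) 0) < 1}" for K :: "'b multiplier"
      by simp
    then show "\<Phi> ` topspace strict_topology \<subseteq>
        \<Union>{{N. norm (lmul (N - M) b) + norm (rmul (N - M) b) < e} | M b e. 0 < e}"
      using zero_less_one by blast
  qed
qed

lemma
  shows star_hom_extend_hom: "star_hom (extend_hom \<phi>)"
    and extend_hom_one: "extend_hom \<phi> 1 = 1"
    and extend_hom_embed: "extend_hom \<phi> (embed s) = \<phi> s"
proof -
  obtain \<Phi> where \<Phi>: "star_hom \<Phi>" "\<Phi> 1 = 1" "\<And>s. \<Phi> (embed s) = \<phi> s"
    "\<And>M s c. lmul (\<Phi> M) (lmul (\<phi> s) c) = lmul (\<phi> (lmul M s)) c"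
    "\<And>M s c. rmul (\<Phi> M) (adj (lmul (\<phi> s) c)) = adj (lmul (\<phi> (lmul (adj M) s)) c)"
    using ex_extension by blast
  have "extend_hom \<phi> = \<Phi>"
    unfolding extend_hom_def
  proof (rule the_equality)
    show "star_hom \<Phi> \<and> \<Phi> 1 = 1 \<and> continuous_map strict_topology strict_topology \<Phi> \<and>
        (\<forall>s. \<Phi> (embed s) = \<phi> s)"
      using strictly_continuous \<Phi> by blast
  next
    fix \<Psi> assume \<Psi>: "star_hom \<Psi> \<and> \<Psi> 1 = 1 \<and> continuous_map strict_topology strict_topology \<Psi> \<and>
        (\<forall>s. \<Psi> (embed s) = \<phi> s)"
    have "lmul (\<Psi> M) c = lmul (\<Phi> M) c" for M c
    proof -
      obtain s d where c: "c = lmul (\<phi> s) d" by (rule left_factorization)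
      have "\<Psi> M * \<phi> s = \<phi> (lmul M s)"
        using \<Psi> by (metis mult_embed star_hom_mult)
      moreover have "lmul (\<Psi> M) c = lmul (\<Psi> M * \<phi> s) d" by (simp add: c lmul_simps)
      ultimately show ?thesis by (simp add: c \<Phi>(4))
    qed
    then show "\<Psi> = \<Phi>" by (intro ext multiplier_eqI)
  qed
  with \<Phi> show "star_hom (extend_hom \<phi>)" "extend_hom \<phi> 1 = 1" "extend_hom \<phi> (embed s) = \<phi> s"
    by simp_all
qed

lemma extend_hom_unitary:
  assumes "u \<in> unitaries" shows "extend_hom \<phi> u \<in> unitaries"
  using assms by (auto simp: unitaries_def extend_hom_one
      simp flip: star_hom_mult[OF star_hom_extend_hom] star_hom_adj[OF star_hom_extend_hom])

end

section \<open>Representations on Hilbert spaces\<close>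

lemma
  fixes x y z :: "'h::complex_hilbert"
  shows cinner_add_left: "cinner (x + y) z = cinner x z + cinner y z"
    and cinner_scaleC_left: "cinner (c *\<^sub>C x) z = cnj c * cinner x z"
    and cinner_diff_left: "cinner (x - y) z = cinner x z - cinner y z"
    and cinner_diff_right: "cinner x (y - z) = cinner x y - cinner x z"
proof -
  show add: "cinner (x + y) z = cinner x z + cinner y z" for x y z :: 'h
    by (metis cinner_commute cinner_add_right complex_cnj_add)
  show "cinner (c *\<^sub>C x) z = cnj c * cinner x z"
    by (metis cinner_commute cinner_scaleC_right complex_cnj_mult)
  show "cinner (x - y) z = cinner x z - cinner y z"
    using add[of "x - y" y z] by simp
  show "cinner x (y - z) = cinner x y - cinner x z"
    using cinner_add_right[of x "y - z" z] by simp
qed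

lemma cinner_self_eq_0: "cinner x x = 0 \<longleftrightarrow> x = (0 :: 'h::complex_hilbert)"
  by (simp add: cinner_self)

lemma cinner_eqI:
  fixes x y :: "'h::complex_hilbert"
  assumes "csubspace H" "x \<in> H" "y \<in> H" "\<And>z. z \<in> H \<Longrightarrow> cinner x z = cinner y z"
  shows "x = y"
proof -
  have "x - y \<in> H" using assms(1-3) by (rule csubspace_diff)
  then have "cinner (x - y) (x - y) = 0" by (simp only: cinner_diff_left assms(4)) simp
  then show ?thesis by (simp add: cinner_self_eq_0)
qed

lemma bounded_ops_eqI:
  assumes "S \<in> bounded_ops H" "T \<in> bounded_ops H" "\<And>x. x \<in> H \<Longrightarrow> S x = T x"
  shows "S = T"
  using assms unfolding bounded_ops_def by (auto intro: PiE_ext)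

lemma op_adj_eqI:
  assumes "csubspace H" "S \<in> bounded_ops H"
    and "\<And>x y. x \<in> H \<Longrightarrow> y \<in> H \<Longrightarrow> cinner (S x) y = cinner x (T y)"
  shows "op_adj H T = S"
  unfolding op_adj_def
proof (rule the_equality)
  fix R assume R: "R \<in> bounded_ops H \<and> (\<forall>x\<in>H. \<forall>y\<in>H. cinner (R x) y = cinner x (T y))"
  then show "R = S"
    using assms by (intro bounded_ops_eqI[of _ H] cinner_eqI[of H])
      (auto simp: bounded_ops_def PiE_iff)
qed (use assms in auto)

lemma
  assumes "representation H \<pi>"
  shows representation_bounded_ops: "\<pi> a \<in> bounded_ops H"
    and representation_in: "x \<in> H \<Longrightarrow> \<pi> a x \<in> H"
    and representation_undefined: "x \<notin> H \<Longrightarrow> \<pi> a x = undefined"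
    and representation_add_left: "x \<in> H \<Longrightarrow> \<pi> (a + b) x = \<pi> a x + \<pi> b x"
    and representation_scaleC_left: "x \<in> H \<Longrightarrow> \<pi> (c *\<^sub>C a) x = c *\<^sub>C \<pi> a x"
    and representation_mult: "x \<in> H \<Longrightarrow> \<pi> (a * b) x = \<pi> a (\<pi> b x)"
    and representation_adj: "x \<in> H \<Longrightarrow> y \<in> H \<Longrightarrow> cinner (\<pi> (adj a) x) y = cinner x (\<pi> a y)"
    and representation_add_right: "x \<in> H \<Longrightarrow> y \<in> H \<Longrightarrow> \<pi> a (x + y) = \<pi> a x + \<pi> a y"
    and representation_scaleC_right: "x \<in> H \<Longrightarrow> \<pi> a (c *\<^sub>C x) = c *\<^sub>C \<pi> a x"
proof -
  have \<pi>: "\<pi> a \<in> bounded_ops H" for a using assms by (simp add: representation_def)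
  then have ops: "\<pi> a \<in> H \<rightarrow>\<^sub>E H" "\<forall>x\<in>H. \<forall>y\<in>H. \<pi> a (x + y) = \<pi> a x + \<pi> a y"
    "\<forall>c. \<forall>x\<in>H. \<pi> a (c *\<^sub>C x) = c *\<^sub>C \<pi> a x" for a
    by (simp_all add: bounded_ops_def)
  show "\<pi> a \<in> bounded_ops H" by (rule \<pi>)
  show "x \<in> H \<Longrightarrow> \<pi> a x \<in> H" "x \<notin> H \<Longrightarrow> \<pi> a x = undefined"
    using ops(1)[of a] by (blast dest: PiE_mem PiE_arb)+
  show "x \<in> H \<Longrightarrow> y \<in> H \<Longrightarrow> \<pi> a (x + y) = \<pi> a x + \<pi> a y"
    "x \<in> H \<Longrightarrow> \<pi> a (c *\<^sub>C x) = c *\<^sub>C \<pi> a x"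
    using ops(2,3) by blast+
  show "x \<in> H \<Longrightarrow> \<pi> (a + b) x = \<pi> a x + \<pi> b x"
    "x \<in> H \<Longrightarrow> \<pi> (c *\<^sub>C a) x = c *\<^sub>C \<pi> a x"
    "x \<in> H \<Longrightarrow> \<pi> (a * b) x = \<pi> a (\<pi> b x)"
    "x \<in> H \<Longrightarrow> y \<in> H \<Longrightarrow> cinner (\<pi> (adj a) x) y = cinner x (\<pi> a y)"
    using assms unfolding representation_def by blast+
qed

lemma representation_eqI:
  assumes "representation H \<pi>" "representation H \<rho>" "\<And>a x. x \<in> H \<Longrightarrow> \<pi> a x = \<rho> a x"
  shows "\<pi> = \<rho>"
  using assms by (intro ext[of \<pi>] bounded_ops_eqI[of _ H] representation_bounded_ops)

lemma representation_comp_star_hom: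
  assumes "representation H \<sigma>" "star_hom f" shows "representation H (\<sigma> \<circ> f)"
  using assms unfolding representation_def star_hom_def by simp

text \<open>Up to scaling \<open>\<parallel>a\<parallel> < 1\<close>, and if \<open>1 - c\<close> is a self-adjoint square root of \<open>1 - a\<^sup>* a\<close>, then
  \<open>\<parallel>x\<parallel>\<^sup>2 - \<parallel>\<pi> a x\<parallel>\<^sup>2 = \<parallel>x - \<pi> c x\<parallel>\<^sup>2\<close>.\<close>

lemma norm_representation:
  assumes H: "csubspace H" and \<pi>: "representation H \<pi>" and x: "x \<in> H"
  shows "norm (\<pi> a x) \<le> norm a * norm x"
proof -
  have diff: "\<pi> (b - c) x = \<pi> b x - \<pi> c x" for b c
    using representation_add_left[OF \<pi> x, of "b - c" c] by simp
  have "norm (\<pi> a x) \<le> norm x * norm a"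
  proof (rule norm_le_by_strict_scaling[where T = "\<lambda>a. norm (\<pi> a x)"])
    show "norm (\<pi> (r *\<^sub>R a) x) = \<bar>r\<bar> * norm (\<pi> a x)" for r
      by (simp add: scaleR_scaleC representation_scaleC_left[OF \<pi> x] norm_scaleC)
  next
    fix r assume "norm (r *\<^sub>R a) < 1"
    define b where "b = r *\<^sub>R a"
    have b: "norm b < 1" using \<open>norm (r *\<^sub>R a) < 1\<close> by (simp add: b_def)
    then have "norm (adj b * b) < 1" by (simp add: cstar_identity abs_square_less_1)
    then obtain c where c: "adj c = c" "c + c - c * c = adj b * b"
      using ex_sqrt_one_minus[of "adj b * b"] by (metis adj_mult adj_adj)
    have "cinner (\<pi> b x) (\<pi> b x) = cinner x (\<pi> (adj b * b) x)"
      using representation_adj[OF \<pi> x representation_in[OF \<pi> x], of "adj b" b]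
      by (simp add: adj_adj representation_mult[OF \<pi> x])
    also have "\<dots> = cinner x (\<pi> c x) + cinner x (\<pi> c x) - cinner x (\<pi> (c * c) x)"
      by (simp add: diff representation_add_left[OF \<pi> x] cinner_add_right cinner_diff_right flip: c(2))
    also have "\<dots> = cinner x x - cinner (x - \<pi> c x) (x - \<pi> c x)"
      using representation_adj[OF \<pi> x x, of c]
        representation_adj[OF \<pi> x representation_in[OF \<pi> x, of c], of c]
      by (simp add: c(1) cinner_diff_left cinner_diff_right representation_mult[OF \<pi> x])
    finally have "(norm (\<pi> b x))\<^sup>2 = (norm x)\<^sup>2 - (norm (x - \<pi> c x))\<^sup>2"
      unfolding cinner_self of_real_diff[symmetric] of_real_eq_iff .
    then have "(norm (\<pi> b x))\<^sup>2 \<le> (norm x)\<^sup>2" by simp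
    then show "norm (\<pi> (r *\<^sub>R a) x) \<le> norm x" by (simp add: b_def)
  qed
  then show ?thesis by (simp add: mult.commute)
qed

lemma RepI:
  assumes H: "hilbert_space H" and \<pi>: "representation H \<pi>"
    and dense: "H \<subseteq> closure (csubspace hull {\<pi> b x | b x. x \<in> H})"
  shows "\<pi> \<in> Rep H"
proof -
  have "closure (csubspace hull {\<pi> b x | b x. x \<in> H}) \<subseteq> H"
    by (rule closure_csubspace_hull_minimal)
      (use H representation_in[OF \<pi>] in \<open>auto simp: hilbert_space_def\<close>)
  with \<pi> dense show ?thesis by (auto simp: Rep_def)
qed

locale nondegenerate_representation =
  fixes H :: "'h::complex_hilbert set" and \<pi> :: "'b::cstar_algebra \<Rightarrow> 'h \<Rightarrow> 'h"
  assumes hilbert_space: "hilbert_space H" and Rep: "\<pi> \<in> Rep H"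
begin

lemma representation: "representation H \<pi>"
  using Rep by (simp add: Rep_def)

sublocale nondegenerate_module H \<pi>
proof
  show H: "closed H" "csubspace H" using hilbert_space by (simp_all add: hilbert_space_def)
  show "norm (\<pi> a x) \<le> norm a * norm x" if "x \<in> H" for a x
    by (rule norm_representation[OF H(2) representation that])
  show "H \<subseteq> closure (csubspace hull {\<pi> b x | b x. x \<in> H})"
    using Rep by (simp add: Rep_def)
qed (simp_all add: representation_in[OF representation] representation_add_left[OF representation]
    representation_scaleC_left[OF representation] representation_mult[OF representation]
    representation_add_right[OF representation] representation_scaleC_right[OF representation])

lemma representation_extended_act: "representation H (\<lambda>M. restrict (extended_act M) H)"
  unfolding representation_def
proof (intro conjI allI ballI)
  show "restrict (extended_act M) H \<in> bounded_ops H" for M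
    unfolding bounded_ops_def
    by (auto simp: extended_act_in space_add space_scaleC extended_act_add_right
        extended_act_scaleC_right norm_extended_act intro!: exI[of _ "2 * norm M"])
next
  fix M N x assume x: "x \<in> H"
  show "restrict (extended_act (M + N)) H x = restrict (extended_act M) H x + restrict (extended_act N) H x"
    using x by (simp add: extended_act_add_left)
  show "restrict (extended_act (c *\<^sub>C M)) H x = c *\<^sub>C restrict (extended_act M) H x" for c
    using x by (simp add: extended_act_scaleC_left)
  show "restrict (extended_act (M * N)) H x = restrict (extended_act M) H (restrict (extended_act N) H x)"
    using x by (simp add: extended_act_mult extended_act_in)
next
  fix M x y assume x: "x \<in> H" and y: "y \<in> H"
  obtain l x' where x': "x' \<in> H" "x = \<pi> l x'" using x by (rule cohen_factorization)
  obtain k y' where y': "y' \<in> H" "y = \<pi> k y'" using y by (rule cohen_factorization)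
  have "cinner (extended_act (adj M) x) y = cinner (\<pi> (adj (rmul M (adj l))) x') (\<pi> k y')"
    by (simp add: x' y' extended_act_act mul_adj)
  also have "\<dots> = cinner x' (\<pi> (rmul M (adj l) * k) y')"
    by (simp add: representation_adj[OF representation] x' y' act_in act_mult)
  also have "\<dots> = cinner x' (\<pi> (adj l * lmul M k) y')" by (simp add: mult_lmul)
  also have "\<dots> = cinner (\<pi> (adj (adj l)) x') (\<pi> (lmul M k) y')"
    by (subst representation_adj[OF representation]) (simp_all add: x' y' act_in act_mult)
  also have "\<dots> = cinner x (extended_act M y)"
    by (simp add: x' y' extended_act_act adj_adj)
  finally show "cinner (restrict (extended_act (adj M)) H x) y = cinner x (restrict (extended_act M) H y)"
    using x y by simp
qed

lemma extension_on_range: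
  assumes "representation H \<sigma>" "\<And>b. \<sigma> (embed b) = \<pi> b" "y \<in> H"
  shows "\<sigma> M (\<pi> l y) = \<pi> (lmul M l) y"
  using representation_mult[OF assms(1,3), of M "embed l"] by (simp add: mult_embed assms(2))

lemma extension_unique:
  assumes "representation H \<sigma>" "\<And>b. \<sigma> (embed b) = \<pi> b"
    and "representation H \<tau>" "\<And>b. \<tau> (embed b) = \<pi> b"
  shows "\<sigma> = \<tau>"
proof (rule representation_eqI[OF assms(1,3)])
  fix M x assume "x \<in> H"
  then obtain l y where "y \<in> H" "x = \<pi> l y" by (rule cohen_factorization)
  then show "\<sigma> M x = \<tau> M x"
    using extension_on_range[OF assms(1,2)] extension_on_range[OF assms(3,4)] by simp
qed

lemma extend_rep_eqI:
  assumes "representation H \<sigma>" "\<And>b. \<sigma> (embed b) = \<pi> b" shows "extend_rep H \<pi> = \<sigma>"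
  unfolding extend_rep_def
proof (rule the_equality)
  show "representation H \<sigma> \<and> (\<forall>b. \<sigma> (embed b) = \<pi> b)" using assms by blast
  show "\<tau> = \<sigma>" if "representation H \<tau> \<and> (\<forall>b. \<tau> (embed b) = \<pi> b)" for \<tau>
    by (rule extension_unique[OF _ _ assms]) (use that in blast)+
qed

lemma restrict_extended_act_embed: "restrict (extended_act (embed b)) H = \<pi> b"
  by (auto simp: extended_act_embed representation_undefined[OF representation] restrict_def)

lemma extend_rep_eq_extended_act: "extend_rep H \<pi> = (\<lambda>M. restrict (extended_act M) H)"
  by (intro extend_rep_eqI representation_extended_act restrict_extended_act_embed)

lemma
  shows representation_extend_rep: "representation H (extend_rep H \<pi>)"
    and extend_rep_embed: "extend_rep H \<pi> (embed b) = \<pi> b"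
    and extend_rep_one: "x \<in> H \<Longrightarrow> extend_rep H \<pi> 1 x = x"
  by (simp_all add: extend_rep_eq_extended_act representation_extended_act
      restrict_extended_act_embed extended_act_one)

text \<open>A vector \<open>\<pi> b y\<close> annihilated by \<open>\<pi> b\<^sup>*\<close> is orthogonal to itself.\<close>

lemma eq_zero_if_annihilated:
  assumes "x \<in> H" "\<And>a. \<pi> a x = 0" shows "x = 0"
proof -
  obtain b y where y: "y \<in> H" "x = \<pi> b y" using assms(1) by (rule cohen_factorization)
  have "cinner x x = cinner (\<pi> (adj (adj b)) y) x" by (simp add: y adj_adj)
  also have "\<dots> = cinner y (\<pi> (adj b) x)" by (rule representation_adj[OF representation y(1) assms(1)])
  also have "\<dots> = 0" using cinner_scaleC_right[of y 0 0] by (simp add: assms(2) scaleC_zero_left)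
  finally show ?thesis by (simp add: cinner_self_eq_0)
qed

end

section \<open>Orthogonal projections\<close>

lemma parallelogram:
  fixes a b :: "'h::complex_hilbert"
  shows "(norm (a + b))\<^sup>2 + (norm (a - b))\<^sup>2 = 2 * (norm a)\<^sup>2 + 2 * (norm b)\<^sup>2"
proof -
  have "cinner (a + b) (a + b) + cinner (a - b) (a - b) = 2 * cinner a a + 2 * cinner b b"
    by (simp add: cinner_add_left cinner_add_right cinner_diff_left cinner_diff_right)
  then have "complex_of_real ((norm (a + b))\<^sup>2 + (norm (a - b))\<^sup>2) =
      complex_of_real (2 * (norm a)\<^sup>2 + 2 * (norm b)\<^sup>2)"
    by (simp add: cinner_self)
  then show ?thesis by (simp only: of_real_eq_iff)
qed

lemma norm_diff_scaled_inner:
  fixes m n :: "'h::complex_hilbert" and s :: real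
  shows "(norm (m - (s * cinner n m) *\<^sub>C n))\<^sup>2 =
    (norm m)\<^sup>2 - 2 * s * (cmod (cinner n m))\<^sup>2 + s\<^sup>2 * (cmod (cinner n m))\<^sup>2 * (norm n)\<^sup>2"
proof -
  define t where "t = cinner n m"
  have mn: "cinner m n = cnj t" by (simp add: t_def cinner_commute[of m n])
  have tt: "t * cnj t = complex_of_real ((cmod t)\<^sup>2)" by (simp only: complex_norm_square)
  have "cinner (m - (s * t) *\<^sub>C n) (m - (s * t) *\<^sub>C n) =
      cinner m m - 2 * s * (t * cnj t) + s\<^sup>2 * (t * cnj t) * cinner n n"
    by (simp add: cinner_diff_left cinner_diff_right cinner_scaleC_left cinner_scaleC_right mn
        t_def[symmetric] algebra_simps power2_eq_square)
  then have "complex_of_real ((norm (m - (s * t) *\<^sub>C n))\<^sup>2) =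
      complex_of_real ((norm m)\<^sup>2 - 2 * s * (cmod t)\<^sup>2 + s\<^sup>2 * (cmod t)\<^sup>2 * (norm n)\<^sup>2)"
    unfolding cinner_self tt by simp
  then show ?thesis unfolding of_real_eq_iff t_def .
qed

text \<open>The projection is the point of \<open>N\<close> nearest to \<open>x\<close>. A minimizing sequence is Cauchy by the
  parallelogram law, and moving the minimizer a little in the direction of the component of
  \<open>x - p\<close> along \<open>n\<close> would decrease the distance unless that component vanishes.\<close>

lemma ex_orthogonal_projection:
  fixes N :: "'h::complex_hilbert set"
  assumes N: "closed N" "csubspace N"
  shows "\<exists>p\<in>N. \<forall>n\<in>N. cinner n (x - p) = 0"
proof -
  define D where "D n = (norm (x - n))\<^sup>2" for n
  define d where "d = (INF n\<in>N. D n)"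
  have ne: "N \<noteq> {}" using csubspace_zero[OF N(2)] by blast
  have bdd: "bdd_below (D ` N)" by (rule bdd_belowI[of _ 0]) (auto simp: D_def)
  have d_le: "d \<le> D n" if "n \<in> N" for n
    unfolding d_def using bdd that by (rule cINF_lower)
  have "\<exists>n\<in>N. D n < d + 1 / real (Suc k)" for k
    using cINF_less_iff[OF ne bdd, of "d + 1 / real (Suc k)"] by (simp add: d_def)
  then obtain f where f: "\<And>k. f k \<in> N" "\<And>k. D (f k) < d + 1 / real (Suc k)" by metis
  have close: "(norm (m - n))\<^sup>2 \<le> 2 * (D m - d) + 2 * (D n - d)" if mn: "m \<in> N" "n \<in> N" for m n
  proof -
    let ?c = "(1/2) *\<^sub>R (m + n)"
    have "(x - m) + (x - n) = 2 *\<^sub>R (x - ?c)" by (simp add: scaleR_diff_right scaleR_2)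
    then have "(norm ((x - m) + (x - n)))\<^sup>2 = 4 * D ?c" by (simp add: D_def power_mult_distrib)
    moreover have "d \<le> D ?c"
      by (intro d_le csubspace_scaleR[OF N(2)] csubspace_add[OF N(2)] mn)
    moreover have "norm ((x - m) - (x - n)) = norm (m - n)" by (simp add: norm_minus_commute)
    ultimately show ?thesis using parallelogram[of "x - m" "x - n"] by (simp add: D_def)
  qed
  have "Cauchy f"
  proof (rule metric_CauchyI)
    fix \<epsilon> :: real assume \<epsilon>: "0 < \<epsilon>"
    then obtain M where M: "1 / real (Suc M) < \<epsilon>\<^sup>2 / 4"
      using reals_Archimedean[of "\<epsilon>\<^sup>2 / 4"] by (auto simp: inverse_eq_divide)
    have small: "D (f k) - d < \<epsilon>\<^sup>2 / 4" if "M \<le> k" for k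
    proof -
      have "1 / real (Suc k) \<le> 1 / real (Suc M)" using that by (simp add: frac_le)
      then show ?thesis using f(2)[of k] M by linarith
    qed
    have "dist (f j) (f k) < \<epsilon>" if "M \<le> j" "M \<le> k" for j k
    proof -
      have "(norm (f j - f k))\<^sup>2 < \<epsilon>\<^sup>2"
        using close[OF f(1)[of j] f(1)[of k]] add_strict_mono[OF small[OF that(1)] small[OF that(2)]]
        by simp
      then show ?thesis using \<epsilon> by (simp add: dist_norm power2_less_imp_less)
    qed
    then show "\<exists>M. \<forall>j\<ge>M. \<forall>k\<ge>M. dist (f j) (f k) < \<epsilon>" by blast
  qed
  then obtain p where p: "f \<longlonglongrightarrow> p" using Cauchy_convergent convergent_def by blast
  have pN: "p \<in> N" using closed_sequentially[OF N(1) _ p] f(1) by blast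
  have "(\<lambda>k. D (f k)) \<longlonglongrightarrow> D p" unfolding D_def by (intro tendsto_intros p)
  moreover have "(\<lambda>k. d + 1 / real (Suc k)) \<longlonglongrightarrow> d + 0"
    by (intro tendsto_add tendsto_const LIMSEQ_inverse_real_of_nat[unfolded inverse_eq_divide])
  ultimately have Dp: "D p \<le> d"
    using LIMSEQ_le[of "\<lambda>k. D (f k)" "D p" "\<lambda>k. d + 1 / real (Suc k)" "d + 0"] f(2)
    by (auto intro: less_imp_le)
  have "cinner n (x - p) = 0" if n: "n \<in> N" for n
  proof -
    define t where "t = (cmod (cinner n (x - p)))\<^sup>2"
    define s where "s = 1 / ((norm n)\<^sup>2 + 1)"
    have pos: "0 < (norm n)\<^sup>2 + 1" by (simp add: add_nonneg_pos)
    have s: "0 < s" "s * (norm n)\<^sup>2 \<le> 1" using pos by (simp_all add: s_def)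
    have "p + (s * cinner n (x - p)) *\<^sub>C n \<in> N"
      by (intro csubspace_add[OF N(2)] csubspace_scaleC[OF N(2)] pN n)
    then have "D p \<le> D (p + (s * cinner n (x - p)) *\<^sub>C n)"
      using Dp by (blast intro: order_trans d_le)
    then have "D p \<le> (norm (x - p - (s * cinner n (x - p)) *\<^sub>C n))\<^sup>2"
      by (simp add: D_def diff_diff_eq)
    then have "2 * s * t \<le> s * t * (s * (norm n)\<^sup>2)"
      unfolding norm_diff_scaled_inner by (simp add: D_def t_def power2_eq_square algebra_simps)
    also have "\<dots> \<le> s * t * 1" using s by (intro mult_left_mono) (simp_all add: t_def)
    finally have "s * t \<le> 0" by simp
    then have "t = 0" using s(1) by (simp add: t_def mult_le_0_iff)
    then show ?thesis by (simp add: t_def)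
  qed
  with pN show ?thesis by blast
qed

locale closed_csubspace =
  fixes N :: "'h::complex_hilbert set"
  assumes closed: "closed N" and csubspace: "csubspace N"
begin

definition projection :: "'h \<Rightarrow> 'h" where
  "projection x = (SOME p. p \<in> N \<and> (\<forall>n\<in>N. cinner n (x - p) = 0))"

lemma
  shows projection_in: "projection x \<in> N"
    and projection_orthogonal: "n \<in> N \<Longrightarrow> cinner n (x - projection x) = 0"
proof -
  have "\<exists>p. p \<in> N \<and> (\<forall>n\<in>N. cinner n (x - p) = 0)"
    using ex_orthogonal_projection[OF closed csubspace] by blast
  from someI_ex[OF this] show "projection x \<in> N"
    "n \<in> N \<Longrightarrow> cinner n (x - projection x) = 0"
    unfolding projection_def by blast+
qed

lemma projection_eqI:
  assumes "q \<in> N" "\<And>n. n \<in> N \<Longrightarrow> cinner n (x - q) = 0"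
  shows "projection x = q"
proof -
  let ?n = "projection x - q"
  have n: "?n \<in> N" using projection_in assms(1) by (rule csubspace_diff[OF csubspace])
  have "cinner ?n (x - q) - cinner ?n (x - projection x) = 0"
    using assms(2)[OF n] projection_orthogonal[OF n, of x] by simp
  then have "cinner ?n ?n = 0" by (simp flip: cinner_diff_right)
  then show ?thesis by (simp add: cinner_self_eq_0)
qed

lemma projection_add: "projection (x + y) = projection x + projection y"
proof (rule projection_eqI)
  show "projection x + projection y \<in> N" by (intro csubspace_add[OF csubspace] projection_in)
  show "cinner n (x + y - (projection x + projection y)) = 0" if "n \<in> N" for n
    using projection_orthogonal[OF that, of x] projection_orthogonal[OF that, of y]
      cinner_add_right[of n "x - projection x" "y - projection y"]
    by (simp add: algebra_simps)
qed

lemma projection_diff: "projection (x - y) = projection x - projection y"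
  using projection_add[of "x - y" y] by simp

lemma projection_scaleC: "projection (c *\<^sub>C x) = c *\<^sub>C projection x"
proof (rule projection_eqI)
  show "c *\<^sub>C projection x \<in> N" by (intro csubspace_scaleC[OF csubspace] projection_in)
  show "cinner n (c *\<^sub>C x - c *\<^sub>C projection x) = 0" if "n \<in> N" for n
    using projection_orthogonal[OF that, of x]
    by (simp add: cinner_scaleC_right flip: scaleC_diff_right)
qed

lemma projection_fixed: "x \<in> N \<Longrightarrow> projection x = x"
  using cinner_diff_right[of _ x x] by (intro projection_eqI) auto

lemma cinner_projection: "cinner (projection x) y = cinner x (projection y)"
proof -
  have "cinner (projection x) y = cinner (projection x) (projection y)"
    using projection_orthogonal[OF projection_in, of x y] by (simp add: cinner_diff_right)
  also have "\<dots> = cinner x (projection y)"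
    using projection_orthogonal[OF projection_in, of y x]
      cinner_commute[of "x - projection x" "projection y"] by (simp add: cinner_diff_left)
  finally show ?thesis .
qed

text \<open>A unitary involution that determines the subspace as its fixed space.\<close>

definition reflection :: "'h \<Rightarrow> 'h" where
  "reflection x = projection x + projection x - x"

lemma reflection_add: "reflection (x + y) = reflection x + reflection y"
  by (simp add: reflection_def projection_add)

lemma reflection_scaleC: "reflection (c *\<^sub>C x) = c *\<^sub>C reflection x"
  by (simp add: reflection_def projection_scaleC scaleC_add_right scaleC_diff_right)

lemma reflection_reflection: "reflection (reflection x) = x"
  by (simp add: reflection_def projection_add projection_diff projection_fixed projection_in)

lemma cinner_reflection: "cinner (reflection x) y = cinner x (reflection y)"
  by (simp add: reflection_def cinner_add_left cinner_add_right cinner_diff_left cinner_diff_right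
      cinner_projection)

lemma norm_reflection: "norm (reflection x) = norm x"
proof -
  have "cinner (reflection x) (reflection x) = cinner x x"
    by (simp add: cinner_reflection reflection_reflection)
  then have "(norm (reflection x))\<^sup>2 = (norm x)\<^sup>2" by (simp only: cinner_self of_real_eq_iff)
  then show ?thesis by simp
qed

lemma reflection_fixed_iff: "reflection x = x \<longleftrightarrow> x \<in> N"
proof
  assume "reflection x = x"
  then have "2 *\<^sub>R projection x = 2 *\<^sub>R x" by (simp add: reflection_def scaleR_2 algebra_simps)
  then show "x \<in> N" using projection_in[of x] by simp
qed (simp add: reflection_def projection_fixed)

lemma reflection_in:
  assumes "csubspace H" "N \<subseteq> H" "x \<in> H" shows "reflection x \<in> H"
  unfolding reflection_def using assms projection_in[of x]
  by (intro csubspace_diff csubspace_add) auto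

end

section \<open>Subspaces invariant under the group\<close>

lemma
  assumes U: "U \<in> group_Rep H"
  shows group_Rep_unitary: "U g \<in> unitary_ops H"
    and group_Rep_in: "x \<in> H \<Longrightarrow> U g x \<in> H"
    and group_Rep_add: "x \<in> H \<Longrightarrow> y \<in> H \<Longrightarrow> U g (x + y) = U g x + U g y"
    and group_Rep_cinner: "x \<in> H \<Longrightarrow> y \<in> H \<Longrightarrow> cinner (U g x) (U g y) = cinner x y"
    and group_Rep_minus: "x \<in> H \<Longrightarrow> U g (U (- g) x) = x"
proof -
  show u: "U g \<in> unitary_ops H" for g using U by (simp add: group_Rep_def)
  then have "U g \<in> bounded_ops H" for g by (simp add: unitary_ops_def)
  then show "x \<in> H \<Longrightarrow> U g x \<in> H" "x \<in> H \<Longrightarrow> y \<in> H \<Longrightarrow> U g (x + y) = U g x + U g y"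
    unfolding bounded_ops_def by (blast dest: PiE_mem)+
  show "x \<in> H \<Longrightarrow> y \<in> H \<Longrightarrow> cinner (U g x) (U g y) = cinner x y"
    using u by (simp add: unitary_ops_def)
  have mult: "x \<in> H \<Longrightarrow> U (g + h) x = U g (U h x)" for g h x
    using U by (simp add: group_Rep_def)
  show "U g (U (- g) x) = x" if "x \<in> H"
  proof -
    have "U 0 ` H = H" using u by (simp add: unitary_ops_def)
    then have "x \<in> U 0 ` H" using that by simp
    then obtain z where z: "z \<in> H" "x = U 0 z" by (rule imageE)
    have "U g (U (- g) x) = U 0 x" using mult[OF that, of g "- g"] by simp
    also have "\<dots> = x" using mult[OF z(1), of 0 0] by (simp add: z(2))
    finally show ?thesis .
  qed
qed

lemma group_Rep_diff:
  assumes "U \<in> group_Rep H" "csubspace H" "x \<in> H" "y \<in> H"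
  shows "U g (x - y) = U g x - U g y"
  using group_Rep_add[OF assms(1) csubspace_diff[OF assms(2-4)] assms(4)] by simp

text \<open>This reflects that the operators \<open>\<mu> l\<close> lie in the von Neumann algebra generated by the group
  representation \<open>U\<close> that \<open>\<mu>\<close> induces. The reflection \<open>W\<close> in \<open>N\<close> commutes with \<open>U\<close>, so that \<open>\<mu>\<close> and \<open>W \<mu> W\<close>
  both induce \<open>U\<close>; as \<open>\<eta>\<^sup>*\<close> is injective, they are equal, and \<open>\<mu> l\<close> preserves the fixed space
  \<open>N\<close> of \<open>W\<close>.\<close>

lemma host_rep_invariant_subspace:
  assumes H: "hilbert_space H" and inj: "inj_on (eta_star H \<eta>) (Rep H)"
    and \<mu>: "\<mu> \<in> Rep H" and U: "eta_star H \<eta> \<mu> \<in> group_Rep H"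
    and N: "closed N" "csubspace N" "N \<subseteq> H"
    and inv: "\<And>g n. n \<in> N \<Longrightarrow> eta_star H \<eta> \<mu> g n \<in> N"
    and n: "n \<in> N"
  shows "\<mu> l n \<in> N"
proof -
  have cH: "csubspace H" using H by (simp add: hilbert_space_def)
  interpret R: nondegenerate_representation H \<mu> using H \<mu> by unfold_locales
  define \<sigma> where "\<sigma> = extend_rep H \<mu>"
  have \<sigma>: "representation H \<sigma>" unfolding \<sigma>_def by (rule R.representation_extend_rep)
  interpret N: closed_csubspace N using N(1,2) by unfold_locales
  define W where "W = N.reflection"
  note W_add = N.reflection_add[folded W_def] and W_scaleC = N.reflection_scaleC[folded W_def]
    and WW = N.reflection_reflection[folded W_def] and cinner_W = N.cinner_reflection[folded W_def]
    and normW = N.norm_reflection[folded W_def] and W_fixed = N.reflection_fixed_iff[folded W_def]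
    and WH = N.reflection_in[OF cH N(3), folded W_def]
  define \<sigma>' where "\<sigma>' M = restrict (\<lambda>x. W (\<sigma> M (W x))) H" for M
  have \<sigma>': "representation H \<sigma>'"
    unfolding representation_def
  proof (intro conjI allI ballI)
    fix M
    obtain K where K: "\<forall>x\<in>H. norm (\<sigma> M x) \<le> K * norm x"
      using representation_bounded_ops[OF \<sigma>, of M] by (auto simp: bounded_ops_def)
    show "\<sigma>' M \<in> bounded_ops H"
      unfolding bounded_ops_def
    proof (intro CollectI conjI ballI allI)
      show "\<sigma>' M \<in> H \<rightarrow>\<^sub>E H"
        by (simp add: \<sigma>'_def WH representation_in[OF \<sigma>])
      have "norm (\<sigma>' M x) \<le> K * norm x" if "x \<in> H" for x
        using bspec[OF K WH[OF that]] that by (simp add: \<sigma>'_def normW)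
      then show "\<exists>K. \<forall>x\<in>H. norm (\<sigma>' M x) \<le> K * norm x" by blast
      show "\<sigma>' M (x + y) = \<sigma>' M x + \<sigma>' M y" if "x \<in> H" "y \<in> H" for x y
        using that by (simp add: \<sigma>'_def csubspace_add[OF cH] W_add WH representation_add_right[OF \<sigma>])
      show "\<sigma>' M (c *\<^sub>C x) = c *\<^sub>C \<sigma>' M x" if "x \<in> H" for c x
        using that by (simp add: \<sigma>'_def csubspace_scaleC[OF cH] W_scaleC WH representation_scaleC_right[OF \<sigma>])
    qed
  next
    fix M K x assume x: "x \<in> H"
    show "\<sigma>' (M + K) x = \<sigma>' M x + \<sigma>' K x"
      using x by (simp add: \<sigma>'_def representation_add_left[OF \<sigma>] WH W_add)
    show "\<sigma>' (c *\<^sub>C M) x = c *\<^sub>C \<sigma>' M x" for c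
      using x by (simp add: \<sigma>'_def representation_scaleC_left[OF \<sigma>] WH W_scaleC)
    show "\<sigma>' (M * K) x = \<sigma>' M (\<sigma>' K x)"
      using x by (simp add: \<sigma>'_def representation_mult[OF \<sigma>] representation_in[OF \<sigma>] WH WW)
    show "cinner (\<sigma>' (adj M) x) y = cinner x (\<sigma>' M y)" if "y \<in> H" for y
      using x that by (simp add: \<sigma>'_def cinner_W representation_adj[OF \<sigma>] WH)
  qed
  define \<mu>' where "\<mu>' b = \<sigma>' (embed b)" for b
  have \<mu>'_apply: "\<mu>' b x = W (\<mu> b (W x))" if "x \<in> H" for b x
    using that by (simp add: \<mu>'_def \<sigma>'_def \<sigma>_def R.extend_rep_embed)
  have \<mu>': "\<mu>' \<in> Rep H"
  proof (rule RepI[OF H])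
    show "representation H \<mu>'"
      using representation_comp_star_hom[OF \<sigma>' star_hom_embed] by (simp add: \<mu>'_def[abs_def] comp_def)
    show "H \<subseteq> closure (csubspace hull {\<mu>' b x | b x. x \<in> H})"
    proof
      fix x assume "x \<in> H"
      then obtain b y where y: "y \<in> H" "W x = \<mu> b y" by (metis R.cohen_factorization WH)
      have "x = \<mu>' b (W y)" using WW[of x] by (simp add: \<mu>'_apply WH y WW)
      then have "x \<in> {\<mu>' b x | b x. x \<in> H}" using WH[OF y(1)] by blast
      then show "x \<in> closure (csubspace hull {\<mu>' b x | b x. x \<in> H})"
        by (intro subsetD[OF closure_subset] hull_inc)
    qed
  qed
  interpret R': nondegenerate_representation H \<mu>' using H \<mu>' by unfold_locales
  have ext: "extend_rep H \<mu>' = \<sigma>'"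
    by (rule R'.extend_rep_eqI[OF \<sigma>']) (simp add: \<mu>'_def)
  have commute: "W (eta_star H \<eta> \<mu> g x) = eta_star H \<eta> \<mu> g (W x)" if x: "x \<in> H" for g x
  proof -
    let ?U = "eta_star H \<eta> \<mu>"
    have p: "N.projection x \<in> N" "N.projection x \<in> H" using N.projection_in N(3) by blast+
    have "N.projection (?U g x) = ?U g (N.projection x)"
    proof (rule N.projection_eqI[OF inv[OF p(1)]])
      fix n assume n: "n \<in> N"
      then have n': "?U (- g) n \<in> N" "?U (- g) n \<in> H" "n \<in> H" using inv N(3) by blast+
      have "cinner n (?U g x - ?U g (N.projection x)) =
          cinner (?U g (?U (- g) n)) (?U g (x - N.projection x))"
        by (simp add: group_Rep_minus[OF U n'(3)] group_Rep_diff[OF U cH x p(2)])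
      also have "\<dots> = cinner (?U (- g) n) (x - N.projection x)"
        by (rule group_Rep_cinner[OF U n'(2) csubspace_diff[OF cH x p(2)]])
      finally show "cinner n (?U g x - ?U g (N.projection x)) = 0"
        by (simp add: N.projection_orthogonal[OF n'(1)])
    qed
    then show ?thesis
      by (simp add: W_def N.reflection_def group_Rep_diff[OF U cH] group_Rep_add[OF U]
          csubspace_add[OF cH] p(2) x)
  qed
  have "eta_star H \<eta> \<mu>' = eta_star H \<eta> \<mu>"
  proof (intro HOL.ext)
    fix g x
    show "eta_star H \<eta> \<mu>' g x = eta_star H \<eta> \<mu> g x"
    proof (cases "x \<in> H")
      case True
      then have "eta_star H \<eta> \<mu>' g x = W (eta_star H \<eta> \<mu> g (W x))"
        by (simp add: eta_star_def ext \<sigma>'_def \<sigma>_def)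
      then show ?thesis by (simp add: commute[OF WH[OF True]] WW)
    next
      case False
      then show ?thesis
        using representation_undefined[OF \<sigma>] by (simp add: eta_star_def ext \<sigma>'_def flip: \<sigma>_def)
    qed
  qed
  then have "\<mu>' = \<mu>" using inj \<mu> \<mu>' by (auto dest: inj_onD)
  then have "W (\<mu> l (W n)) = \<mu> l n" using \<mu>'_apply[of n l] n N(3) by auto
  moreover have "W n = n" using n W_fixed by blast
  ultimately show ?thesis using W_fixed by simp
qed

lemma
  assumes T: "T \<in> bounded_ops H" and H: "hilbert_space H" and N: "closed N" "csubspace N"
  shows closed_bounded_op_vimage: "closed (H \<inter> T -` N)"
    and csubspace_bounded_op_vimage: "csubspace (H \<inter> T -` N)"
proof -
  have add: "\<And>x y. x \<in> H \<Longrightarrow> y \<in> H \<Longrightarrow> T (x + y) = T x + T y"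
    and scaleC: "\<And>c x. x \<in> H \<Longrightarrow> T (c *\<^sub>C x) = c *\<^sub>C T x"
    and cH: "csubspace H" "closed H"
    using T H by (auto simp: bounded_ops_def hilbert_space_def)
  obtain K where K: "\<forall>x\<in>H. norm (T x) \<le> K * norm x"
    using T by (auto simp: bounded_ops_def)
  have "dist (T x) (T y) \<le> \<bar>K\<bar> * dist x y" if "x \<in> H" "y \<in> H" for x y
  proof -
    have xy: "x - y \<in> H" using cH(1) that by (rule csubspace_diff)
    have "T x - T y = T (x - y)" using add[OF xy that(2)] by simp
    then show ?thesis
      using bspec[OF K xy] mult_right_mono[OF abs_ge_self[of K] norm_ge_zero[of "x - y"]]
      by (simp add: dist_norm)
  qed
  then have "continuous_on H T"
    by (intro lipschitz_on_continuous_on[of "\<bar>K\<bar>"] lipschitz_onI) auto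
  then show "closed (H \<inter> T -` N)"
    using cH(2) N(1) by (rule continuous_closed_preimage)
  have "T 0 = 0" using add[of 0 0] csubspace_zero[OF cH(1)] by simp
  then show "csubspace (H \<inter> T -` N)"
    using cH(1) N(2) by (auto simp: csubspace_def add scaleC)
qed

section \<open>Crossed product hosts\<close>

lemma
  assumes "crossed_product_host \<alpha> \<eta> \<eta>A \<eta>L"
  shows crossed_product_host_star_hom: "star_hom \<eta>A"
    and crossed_product_host_nondegenerate_morphism: "nondegenerate_morphism \<eta>L"
    and crossed_product_host_covariant:
      "extend_hom \<eta>L (\<eta> g) * \<eta>A a * adj (extend_hom \<eta>L (\<eta> g)) = \<eta>A (\<alpha> g a)"
    and crossed_product_host_product: "\<exists>c. embed c = \<eta>A a * \<eta>L l"
  using assms unfolding crossed_product_host_def nondegenerate_morphism_def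
  by (auto simp: image_iff) (metis (mono_tags, lifting) mem_Collect_eq rangeE subsetD)

lemma closed_Collect_ball_conj:
  assumes "\<And>x. x \<in> A \<Longrightarrow> closed {c. P c x}" "\<And>x. x \<in> A \<Longrightarrow> closed {c. Q c x}"
  shows "closed {c. \<forall>x\<in>A. P c x \<and> Q c x}"
proof -
  have "{c. \<forall>x\<in>A. P c x \<and> Q c x} = (\<Inter>x\<in>A. {c. P c x} \<inter> {c. Q c x})" by auto
  then show ?thesis using assms by (auto intro!: closed_INT closed_Int)
qed

lemma crossed_product_host_induct:
  assumes "crossed_product_host \<alpha> \<eta> \<eta>A \<eta>L"
    and "\<And>c a l. embed c = \<eta>A a * \<eta>L l \<Longrightarrow> P c" "cstar_subalgebra {c. P c}"
  shows "P c"
proof -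
  have "c \<in> cstar_subalgebra hull {c. \<exists>a l. embed c = \<eta>A a * \<eta>L l}"
    using assms(1) by (simp add: crossed_product_host_def)
  then show ?thesis by (rule hull_induct) (use assms(2,3) in auto)
qed

text \<open>Here \<open>\<sigma>\<close> extends \<open>\<rho>\<close>, and \<open>(\<pi>, U)\<close> with \<open>U\<close> induced by \<open>\<mu>\<close> is the image of \<open>\<rho>\<close>.\<close>

locale crossed_product_representation =
  nondegenerate_representation H \<rho> + L: nondegenerate_morphism \<eta>L
  for H :: "'h::complex_hilbert set" and \<rho> :: "'c::cstar_algebra \<Rightarrow> 'h \<Rightarrow> 'h"
    and \<eta>L :: "'l::cstar_algebra \<Rightarrow> 'c multiplier" +
  fixes \<eta> :: "'g::topological_group_add \<Rightarrow> 'l multiplier"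
    and \<alpha> :: "'g \<Rightarrow> 'a::cstar_algebra \<Rightarrow> 'a" and \<eta>A :: "'a \<Rightarrow> 'c multiplier"
  assumes host: "host_algebra TYPE('h) \<eta>" and cp_host: "crossed_product_host \<alpha> \<eta> \<eta>A \<eta>L"
begin

abbreviation \<sigma> :: "'c multiplier \<Rightarrow> 'h \<Rightarrow> 'h" where "\<sigma> \<equiv> extend_rep H \<rho>"

definition \<pi> :: "'a \<Rightarrow> 'h \<Rightarrow> 'h" where "\<pi> = \<sigma> \<circ> \<eta>A"

definition \<mu> :: "'l \<Rightarrow> 'h \<Rightarrow> 'h" where "\<mu> = \<sigma> \<circ> \<eta>L"

definition U :: "'g \<Rightarrow> 'h \<Rightarrow> 'h" where "U = \<sigma> \<circ> eta_G \<eta> \<eta>L"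

lemmas \<sigma>_mult = representation_mult[OF representation_extend_rep]
  and \<sigma>_adj = representation_adj[OF representation_extend_rep]
  and \<sigma>_in = representation_in[OF representation_extend_rep]

lemma eta_times_star_eq: "eta_times_star H \<eta> \<eta>A \<eta>L \<rho> = (\<pi>, U)"
  by (simp add: eta_times_star_def \<pi>_def U_def)

lemma representation_\<pi>: "representation H \<pi>"
  unfolding \<pi>_def
  by (intro representation_comp_star_hom representation_extend_rep
      crossed_product_host_star_hom[OF cp_host])

lemma representation_\<mu>: "representation H \<mu>"
  unfolding \<mu>_def by (intro representation_comp_star_hom representation_extend_rep L.star_hom)

lemma generator_act:
  assumes "embed c = \<eta>A a * \<eta>L l" "x \<in> H" shows "\<rho> c x = \<pi> a (\<mu> l x)"
  using \<sigma>_mult[OF assms(2), of "\<eta>A a" "\<eta>L l"]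
  by (simp add: \<pi>_def \<mu>_def extend_rep_embed flip: assms(1))

lemma adj_generator_act:
  assumes "embed c = \<eta>A a * \<eta>L l" "x \<in> H" shows "\<rho> (adj c) x = \<mu> (adj l) (\<pi> (adj a) x)"
proof -
  have "embed (adj c) = \<eta>L (adj l) * \<eta>A (adj a)"
    by (simp add: star_hom_adj[OF star_hom_embed] assms(1) adj_mult star_hom_adj[OF L.star_hom]
        star_hom_adj[OF crossed_product_host_star_hom[OF cp_host]])
  then show ?thesis
    using \<sigma>_mult[OF assms(2), of "\<eta>L (adj l)" "\<eta>A (adj a)"]
    by (simp add: \<pi>_def \<mu>_def flip: extend_rep_embed)
qed

lemma \<mu>_Rep: "\<mu> \<in> Rep H"
proof (rule RepI[OF hilbert_space representation_\<mu>], rule subsetI)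
  fix x assume "x \<in> H"
  then obtain c y where y: "y \<in> H" "x = \<rho> c y" by (rule cohen_factorization)
  obtain l d where "c = lmul (\<eta>L l) d" by (rule L.left_factorization)
  then have "embed c = \<eta>L l * embed d" by (simp add: mult_embed)
  then have "x = \<mu> l (\<rho> d y)"
    using \<sigma>_mult[OF y(1), of "\<eta>L l" "embed d"] by (simp add: y(2) \<mu>_def flip: extend_rep_embed)
  then have "x \<in> {\<mu> l x | l x. x \<in> H}" using act_in[OF y(1)] by blast
  then show "x \<in> closure (csubspace hull {\<mu> l x | l x. x \<in> H})"
    by (intro subsetD[OF closure_subset] hull_inc)
qed

text \<open>The extension of \<open>\<mu> = \<sigma> \<circ> \<eta>L\<close> to multipliers is \<open>\<sigma> \<circ> extend_hom \<eta>L\<close>, since the latter is a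
  representation that extends \<open>\<mu>\<close>. So \<open>U\<close> is an \<open>\<L>\<close>-representation.\<close>

lemma U_eq_eta_star: "U = eta_star H \<eta> \<mu>"
proof -
  interpret M: nondegenerate_representation H \<mu>
    using hilbert_space \<mu>_Rep by unfold_locales
  have "extend_rep H \<mu> = \<sigma> \<circ> extend_hom \<eta>L"
    by (rule M.extend_rep_eqI)
      (simp_all add: representation_comp_star_hom representation_extend_rep L.star_hom_extend_hom
        L.extend_hom_embed \<mu>_def)
  then show ?thesis by (simp add: U_def eta_star_def eta_G_def comp_assoc)
qed

lemma U_group_Rep: "U \<in> group_Rep H"
  using host hilbert_space \<mu>_Rep by (simp add: U_eq_eta_star host_algebra_def)

lemma inj_eta_star: "inj_on (eta_star H \<eta>) (Rep H)"
  using host hilbert_space by (simp add: host_algebra_def)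

lemma op_adj_U: "op_adj H (U g) = \<sigma> (adj (eta_G \<eta> \<eta>L g))"
  by (rule op_adj_eqI[OF csubspace_space representation_bounded_ops[OF representation_extend_rep]])
    (simp add: U_def \<sigma>_adj)

lemma eta_G_unitary: "eta_G \<eta> \<eta>L g \<in> unitaries"
  using host L.extend_hom_unitary by (auto simp: host_algebra_def eta_G_def image_subset_iff)

lemma covariance:
  assumes x: "x \<in> H"
  shows "U g (\<pi> a (op_adj H (U g) x)) = \<pi> (\<alpha> g a) x"
proof -
  have "U g (\<pi> a (op_adj H (U g) x)) = \<sigma> (eta_G \<eta> \<eta>L g * \<eta>A a * adj (eta_G \<eta> \<eta>L g)) x"
    unfolding op_adj_U by (simp add: U_def \<pi>_def \<sigma>_mult \<sigma>_in x)
  also have "\<dots> = \<pi> (\<alpha> g a) x"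
    by (simp add: eta_G_def crossed_product_host_covariant[OF cp_host] \<pi>_def)
  finally show ?thesis .
qed

lemma covariance_commute:
  assumes x: "x \<in> H"
  shows "U g (\<pi> a x) = \<pi> (\<alpha> g a) (U g x)"
proof -
  have "op_adj H (U g) (U g x) = \<sigma> (adj (eta_G \<eta> \<eta>L g) * eta_G \<eta> \<eta>L g) x"
    unfolding op_adj_U by (simp add: U_def \<sigma>_mult x)
  also have "\<dots> = x" using eta_G_unitary[of g] by (simp add: unitaries_def extend_rep_one x)
  finally show ?thesis using covariance[OF group_Rep_in[OF U_group_Rep x], of g a g] by simp
qed

text \<open>The closed span \<open>N\<close> of \<open>\<pi>(\<A>) H\<close> is invariant under \<open>U\<close> by covariance, hence under
  \<open>\<mu>\<close>. So the generators \<open>\<pi> a \<mu> l\<close> of \<open>\<rho>(\<C>)\<close> and their adjoints \<open>\<mu> l\<^sup>* \<pi> a\<^sup>*\<close> map \<open>H\<close> into \<open>N\<close>, and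
  \<open>N = H\<close> because \<open>\<rho>\<close> is nondegenerate.\<close>

lemma \<pi>_Rep: "\<pi> \<in> Rep H"
proof (rule RepI[OF hilbert_space representation_\<pi>])
  define N where "N = closure (csubspace hull {\<pi> a x | a x. x \<in> H})"
  have N: "closed N" "csubspace N"
    unfolding N_def by (intro closed_closure csubspace_closure csubspace_hull)+
  have N_H: "N \<subseteq> H"
    unfolding N_def by (rule closure_csubspace_hull_minimal)
      (auto simp: representation_in[OF representation_\<pi>] csubspace_space closed_space)
  have \<pi>_N: "\<pi> a x \<in> N" if "x \<in> H" for a x
    unfolding N_def using that by (intro subsetD[OF closure_subset] hull_inc) blast
  have U_bounded: "U g \<in> bounded_ops H" for g
    using group_Rep_unitary[OF U_group_Rep] by (simp add: unitary_ops_def)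
  have "N \<subseteq> H \<inter> U g -` N" for g
    unfolding N_def
  proof (rule closure_csubspace_hull_minimal, fold N_def)
    show "{\<pi> a x | a x. x \<in> H} \<subseteq> H \<inter> U g -` N"
      by (auto simp: covariance_commute \<pi>_N group_Rep_in[OF U_group_Rep]
          representation_in[OF representation_\<pi>])
    show "csubspace (H \<inter> U g -` N)" "closed (H \<inter> U g -` N)"
      by (intro csubspace_bounded_op_vimage closed_bounded_op_vimage U_bounded hilbert_space N)+
  qed
  then have \<mu>_N: "\<mu> l n \<in> N" if "n \<in> N" for l n
    using that host_rep_invariant_subspace[OF hilbert_space inj_eta_star \<mu>_Rep _ N N_H]
      U_group_Rep by (fold U_eq_eta_star) blast
  have "\<forall>x\<in>H. \<rho> c x \<in> N \<and> \<rho> (adj c) x \<in> N" for c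
  proof (induction c rule: crossed_product_host_induct[OF cp_host])
    fix c a l assume c: "embed c = \<eta>A a * \<eta>L l"
    show "\<forall>x\<in>H. \<rho> c x \<in> N \<and> \<rho> (adj c) x \<in> N"
      using \<pi>_N \<mu>_N by (simp add: generator_act[OF c] adj_generator_act[OF c]
          representation_in[OF representation_\<mu>])
  next
    have "closed {c. \<rho> c x \<in> N}" "closed {c. \<rho> (adj c) x \<in> N}" if x: "x \<in> H" for x
    proof -
      have cont: "continuous_on UNIV (\<lambda>c. \<rho> c x)"
        by (rule bounded_linear.continuous_on[OF bounded_linear_act[OF x] continuous_on_id])
      show "closed {c. \<rho> c x \<in> N}"
        using closed_vimage[OF N(1) cont] by (simp add: vimage_def)
      have "continuous_on UNIV (\<lambda>c. \<rho> (adj c) x)"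
        by (intro bounded_linear.continuous_on[OF bounded_linear_act[OF x]]
            bounded_linear.continuous_on[OF bounded_linear_adj] continuous_on_id)
      then show "closed {c. \<rho> (adj c) x \<in> N}"
        using closed_vimage[OF N(1)] by (simp add: vimage_def)
    qed
    then have "closed {c. \<forall>x\<in>H. \<rho> c x \<in> N \<and> \<rho> (adj c) x \<in> N}"
      by (rule closed_Collect_ball_conj)
    then show "cstar_subalgebra {c. \<forall>x\<in>H. \<rho> c x \<in> N \<and> \<rho> (adj c) x \<in> N}"
      unfolding cstar_subalgebra_def csubspace_def
      by (auto simp: act_zero_left adj_zero act_add_left adj_add act_scaleC_left adj_scaleC
          act_mult adj_mult adj_adj act_in csubspace_zero[OF N(2)]
          intro: csubspace_add[OF N(2)] csubspace_scaleC[OF N(2)])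
  qed
  then have "closure (csubspace hull {\<rho> c x | c x. x \<in> H}) \<subseteq> N"
    by (intro closure_csubspace_hull_minimal N) blast
  then show "H \<subseteq> closure (csubspace hull {\<pi> a x | a x. x \<in> H})"
    using nondegenerate by (simp add: N_def)
qed

lemma eta_times_star_in_cov_Rep_host: "(\<pi>, U) \<in> cov_Rep_host H \<alpha> \<eta>"
proof -
  have "U \<in> eta_star H \<eta> ` Rep H" using \<mu>_Rep U_eq_eta_star by blast
  then show ?thesis by (simp add: cov_Rep_host_def cov_Rep_def \<pi>_Rep U_group_Rep covariance)
qed

end

lemma crossed_product_representationI:
  fixes \<eta> :: "'g::topological_group_add \<Rightarrow> 'l::cstar_algebra multiplier"
    and H :: "'h::complex_hilbert set"
  assumes "host_algebra TYPE('h) \<eta>" "crossed_product_host \<alpha> \<eta> \<eta>A \<eta>L" "hilbert_space H" "\<rho> \<in> Rep H"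
  shows "crossed_product_representation H \<rho> \<eta>L \<eta> \<alpha> \<eta>A"
  using assms crossed_product_host_nondegenerate_morphism[OF assms(2)]
  by (simp add: crossed_product_representation_def nondegenerate_representation_def
      crossed_product_representation_axioms_def)

text \<open>From \<open>U\<close> the host algebra recovers \<open>\<mu>\<close>, and \<open>\<rho>\<close> is determined by \<open>\<pi>\<close> and \<open>\<mu>\<close> on the generators.\<close>

lemma inj_eta_times_star:
  fixes \<eta> :: "'g::topological_group_add \<Rightarrow> 'l::cstar_algebra multiplier"
    and H :: "'h::complex_hilbert set"
  assumes hyps: "host_algebra TYPE('h) \<eta>" "crossed_product_host \<alpha> \<eta> \<eta>A \<eta>L" "hilbert_space H"
  shows "inj_on (eta_times_star H \<eta> \<eta>A \<eta>L) (Rep H)"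
proof (rule inj_onI)
  fix \<rho> \<rho>' assume \<rho>: "\<rho> \<in> Rep H" "\<rho>' \<in> Rep H"
    and eq: "eta_times_star H \<eta> \<eta>A \<eta>L \<rho> = eta_times_star H \<eta> \<eta>A \<eta>L \<rho>'"
  interpret R: crossed_product_representation H \<rho> \<eta>L \<eta> \<alpha> \<eta>A
    by (rule crossed_product_representationI[OF hyps \<rho>(1)])
  interpret R': crossed_product_representation H \<rho>' \<eta>L \<eta> \<alpha> \<eta>A
    by (rule crossed_product_representationI[OF hyps \<rho>(2)])
  have \<pi>: "R.\<pi> = R'.\<pi>" and "R.U = R'.U"
    using eq by (simp_all add: R.eta_times_star_eq R'.eta_times_star_eq)
  then have \<mu>: "R.\<mu> = R'.\<mu>"
    using R.inj_eta_star R.\<mu>_Rep R'.\<mu>_Rep by (simp add: R.U_eq_eta_star R'.U_eq_eta_star inj_on_eq_iff)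
  have "\<forall>x\<in>H. \<rho> c x = \<rho>' c x \<and> \<rho> (adj c) x = \<rho>' (adj c) x" for c
  proof (induction c rule: crossed_product_host_induct[OF hyps(2)])
    fix c a l assume c: "embed c = \<eta>A a * \<eta>L l"
    show "\<forall>x\<in>H. \<rho> c x = \<rho>' c x \<and> \<rho> (adj c) x = \<rho>' (adj c) x"
      by (simp add: R.generator_act[OF c] R'.generator_act[OF c] R.adj_generator_act[OF c]
          R'.adj_generator_act[OF c] \<pi> \<mu>)
  next
    have "closed {c. \<rho> c x = \<rho>' c x}" "closed {c. \<rho> (adj c) x = \<rho>' (adj c) x}" if x: "x \<in> H" for x
      by (intro closed_Collect_eq bounded_linear.continuous_on[OF R.bounded_linear_act[OF x]]
          bounded_linear.continuous_on[OF R'.bounded_linear_act[OF x]]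
          bounded_linear.continuous_on[OF bounded_linear_adj] continuous_on_id)+
    then have "closed {c. \<forall>x\<in>H. \<rho> c x = \<rho>' c x \<and> \<rho> (adj c) x = \<rho>' (adj c) x}"
      by (rule closed_Collect_ball_conj)
    then show "cstar_subalgebra {c. \<forall>x\<in>H. \<rho> c x = \<rho>' c x \<and> \<rho> (adj c) x = \<rho>' (adj c) x}"
      unfolding cstar_subalgebra_def csubspace_def
      by (simp add: R.act_zero_left R'.act_zero_left adj_zero R.act_add_left R'.act_add_left adj_add
          R.act_scaleC_left R'.act_scaleC_left adj_scaleC R.act_mult R'.act_mult adj_mult adj_adj
          R'.act_in)
  qed
  then show "\<rho> = \<rho>'"
    by (intro representation_eqI[OF R.representation R'.representation]) blast
qed

text \<open>Fullness provides \<open>\<rho>\<close> with \<open>\<pi>' a \<mu>' l = \<pi> a \<mu> l\<close>, where \<open>(\<pi>', U')\<close> is the image of \<open>\<rho>\<close> and \<open>\<mu>'\<close>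
  induces \<open>U'\<close>. Comparing the factors separately: \<open>\<pi>' a\<close> and \<open>\<pi> a\<close> agree on the total set of
  vectors \<open>\<pi> b \<mu> l x = \<pi>' b \<mu>' l x\<close>, and then \<open>\<pi> a (\<mu>' l x - \<mu> l x) = 0\<close> for all \<open>a\<close>.\<close>

lemma full_crossed_product_host_surj:
  fixes \<eta> :: "'g::topological_group_add \<Rightarrow> 'l::cstar_algebra multiplier"
    and H :: "'h::complex_hilbert set"
  assumes host: "host_algebra TYPE('h) \<eta>" and full: "full_crossed_product_host TYPE('h) \<alpha> \<eta> \<eta>A \<eta>L"
    and H: "hilbert_space H" and \<pi>U: "(\<pi>, U) \<in> cov_Rep_host H \<alpha> \<eta>"
  shows "(\<pi>, U) \<in> eta_times_star H \<eta> \<eta>A \<eta>L ` Rep H"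
proof -
  have cp: "crossed_product_host \<alpha> \<eta> \<eta>A \<eta>L"
    using full by (simp add: full_crossed_product_host_def)
  define \<mu> where "\<mu> = host_rep H \<eta> U"
  have U: "U \<in> eta_star H \<eta> ` Rep H" and \<pi>: "\<pi> \<in> Rep H"
    using \<pi>U by (auto simp: cov_Rep_host_def cov_Rep_def)
  then have \<mu>: "\<mu> \<in> Rep H" "eta_star H \<eta> \<mu> = U"
    by (simp_all add: \<mu>_def host_rep_def inv_into_into f_inv_into_f)
  interpret P: nondegenerate_representation H \<pi> using H \<pi> by unfold_locales
  interpret M: nondegenerate_representation H \<mu> using H \<mu>(1) by unfold_locales
  have "\<exists>!\<rho>. representation H \<rho> \<and>
      (\<forall>a l c. embed c = \<eta>A a * \<eta>L l \<longrightarrow> (\<forall>x\<in>H. \<rho> c x = \<pi> a (host_rep H \<eta> U l x)))"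
    using full H \<pi>U unfolding full_crossed_product_host_def by blast
  then obtain \<rho> where rep: "representation H \<rho>"
    and gen: "\<And>a l c x. embed c = \<eta>A a * \<eta>L l \<Longrightarrow> x \<in> H \<Longrightarrow> \<rho> c x = \<pi> a (\<mu> l x)"
    unfolding \<mu>_def by blast
  have "\<rho> \<in> Rep H"
  proof (rule RepI[OF H rep], rule subsetI)
    fix x assume "x \<in> H"
    then obtain a y where y: "y \<in> H" "x = \<pi> a y" by (rule P.cohen_factorization)
    obtain l z where z: "z \<in> H" "y = \<mu> l z" using y(1) by (rule M.cohen_factorization)
    obtain c where "embed c = \<eta>A a * \<eta>L l" using crossed_product_host_product[OF cp] by blast
    then have "x = \<rho> c z" using gen z(1) by (simp add: y(2) z(2))
    then have "x \<in> {\<rho> c x | c x. x \<in> H}" using z(1) by blast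
    then show "x \<in> closure (csubspace hull {\<rho> c x | c x. x \<in> H})"
      by (intro subsetD[OF closure_subset] hull_inc)
  qed
  then interpret R: crossed_product_representation H \<rho> \<eta>L \<eta> \<alpha> \<eta>A
    by (rule crossed_product_representationI[OF host cp H])
  have products: "R.\<pi> a (R.\<mu> l x) = \<pi> a (\<mu> l x)" if x: "x \<in> H" for a l x
  proof -
    obtain c where "embed c = \<eta>A a * \<eta>L l" using crossed_product_host_product[OF cp] by blast
    then show ?thesis using gen R.generator_act x by metis
  qed
  have R\<mu>_in: "R.\<mu> l x \<in> H" if "x \<in> H" for l x
    by (rule representation_in[OF R.representation_\<mu> that])
  have \<pi>_eq: "R.\<pi> = \<pi>"
  proof (rule representation_eqI[OF R.representation_\<pi> P.representation])
    fix a x assume "x \<in> H"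
    then obtain b y where y: "y \<in> H" "x = \<pi> b y" by (rule P.cohen_factorization)
    obtain l z where z: "z \<in> H" "y = \<mu> l z" using y(1) by (rule M.cohen_factorization)
    have "R.\<pi> a x = R.\<pi> (a * b) (R.\<mu> l z)"
      by (simp add: y z products[symmetric] representation_mult[OF R.representation_\<pi>] R\<mu>_in)
    also have "\<dots> = \<pi> a x" by (simp add: products y z P.act_mult M.act_in)
    finally show "R.\<pi> a x = \<pi> a x" .
  qed
  have "R.\<mu> = \<mu>"
  proof (rule representation_eqI[OF R.representation_\<mu> M.representation])
    fix l x assume x: "x \<in> H"
    have "R.\<mu> l x - \<mu> l x = 0"
    proof (rule P.eq_zero_if_annihilated)
      show "R.\<mu> l x - \<mu> l x \<in> H" by (intro P.space_diff R\<mu>_in M.act_in x)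
      show "\<pi> a (R.\<mu> l x - \<mu> l x) = 0" for a
        using products[OF x, of a l] by (simp add: \<pi>_eq P.act_diff_right R\<mu>_in M.act_in x)
    qed
    then show "R.\<mu> l x = \<mu> l x" by simp
  qed
  then have "R.U = U" by (simp add: R.U_eq_eta_star \<mu>(2))
  then show ?thesis using R.eta_times_star_eq R.Rep by (metis \<pi>_eq image_eqI)
qed

theorem theorem4p5:
  fixes \<eta> :: "'g::topological_group_add \<Rightarrow> 'l::cstar_algebra multiplier"
    and \<alpha> :: "'g \<Rightarrow> 'a::cstar_algebra \<Rightarrow> 'a"
    and \<eta>A :: "'a \<Rightarrow> 'c::cstar_algebra multiplier"
    and \<eta>L :: "'l \<Rightarrow> 'c multiplier"
    and H :: "'h::complex_hilbert set"
  assumes "host_algebra TYPE('h) \<eta>"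
    and "cstar_action \<alpha>"
    and "crossed_product_host \<alpha> \<eta> \<eta>A \<eta>L"
    and "hilbert_space H"
  shows "range (eta_G \<eta> \<eta>L) \<subseteq> unitaries \<and>
    eta_times_star H \<eta> \<eta>A \<eta>L ` Rep H \<subseteq> cov_Rep H \<alpha> \<and>
    inj_on (eta_times_star H \<eta> \<eta>A \<eta>L) (Rep H) \<and>
    eta_times_star H \<eta> \<eta>A \<eta>L ` Rep H \<subseteq> cov_Rep_host H \<alpha> \<eta> \<and>
    (full_crossed_product_host TYPE('h) \<alpha> \<eta> \<eta>A \<eta>L \<longrightarrow>
       eta_times_star H \<eta> \<eta>A \<eta>L ` Rep H = cov_Rep_host H \<alpha> \<eta>)"
proof (intro conjI impI)
  interpret L: nondegenerate_morphism \<eta>L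
    by (rule crossed_product_host_nondegenerate_morphism[OF assms(3)])
  show "range (eta_G \<eta> \<eta>L) \<subseteq> unitaries"
    using assms(1) L.extend_hom_unitary by (auto simp: eta_G_def host_algebra_def image_subset_iff)
  show image: "eta_times_star H \<eta> \<eta>A \<eta>L ` Rep H \<subseteq> cov_Rep_host H \<alpha> \<eta>"
  proof (rule image_subsetI)
    fix \<rho> :: "'c \<Rightarrow> 'h \<Rightarrow> 'h" assume "\<rho> \<in> Rep H"
    then interpret R: crossed_product_representation H \<rho> \<eta>L \<eta> \<alpha> \<eta>A
      by (rule crossed_product_representationI[OF assms(1,3,4)])
    show "eta_times_star H \<eta> \<eta>A \<eta>L \<rho> \<in> cov_Rep_host H \<alpha> \<eta>"
      by (simp add: R.eta_times_star_eq R.eta_times_star_in_cov_Rep_host)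
  qed
  then show "eta_times_star H \<eta> \<eta>A \<eta>L ` Rep H \<subseteq> cov_Rep H \<alpha>"
    by (auto simp: cov_Rep_host_def)
  show "inj_on (eta_times_star H \<eta> \<eta>A \<eta>L) (Rep H)"
    by (rule inj_eta_times_star[OF assms(1,3,4)])
  assume full: "full_crossed_product_host TYPE('h) \<alpha> \<eta> \<eta>A \<eta>L"
  show "eta_times_star H \<eta> \<eta>A \<eta>L ` Rep H = cov_Rep_host H \<alpha> \<eta>"
    using image full_crossed_product_host_surj[OF assms(1) full assms(4)] by auto
qed

end
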